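(* Let $\mathfrak{a}$ be a nonzero proper ideal of $R=\mathcal{O}[1/\eta]$ with prime factorization $\mathfrak{a}=\mathfrak{p}_1^{e_1}\cdots\mathfrak{p}_r^{e_r}$ (distinct prime ideals $\mathfrak{p}_i$, $e_i\ge 1$). Then $\mathfrak{a}$ is of degree one if and only if both of the following hold: (i) for each $1\le i\le r$, $\mathfrak{p}_i$ is of degree one, and $e_i=1$ whenever $\mathfrak{p}_i$ is ramified; (ii) $\gcd(\mathfrak{N}(\mathfrak{p}_i),\mathfrak{N}(\mathfrak{p}_j))=1$ for all $1\le i<j\le r$. Furthermore, let $\alpha\in R$ satisfy $L=\mathbb{Q}(\alpha)$, let $f\in\mathbb{Z}[x]$ be the primitive minimal polynomial of $\alpha$ over $\mathbb{Z}$, and let $D_f$ be the discriminant of $f$. If $n\ge 2$ is an integer with $\gcd(n,\eta D_f)=1$, then the maps $v\mapsto (\alpha-v,n)R$ and $\mathfrak{a}\mapsto\alpha(\mathfrak{a})$ are mutually inverse bijections between the set $\{v\in\{0,1,\dots,n-1\}: f(v)\equiv 0 \pmod n\}$ and the set of ideals of $R$ of degree one with $\mathfrak{N}(\mathfrak{a})=n$.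
   Context: Let $L$ be a number field with ring of integers $\mathcal{O}$, let $\eta$ be a positive integer, and put $R=\mathcal{O}[1/\eta]$, $Z_\eta=\mathbb{Z}[1/\eta]$. For a nonzero ideal $\mathfrak{a}$ of $R$, $\mathfrak{N}(\mathfrak{a})=|R/\mathfrak{a}|$ is its absolute norm, and its inertia degree is $\mathfrak{i}(\mathfrak{a})=\log|R/\mathfrak{a}|/\log|Z_\eta/(\mathfrak{a}\cap Z_\eta)|$; $\mathfrak{a}$ is called of degree one if $\mathfrak{i}(\mathfrak{a})=1$, equivalently $R/\mathfrak{a}\cong Z_\eta/(\mathfrak{a}\cap Z_\eta)$. For a degree one ideal $\mathfrak{a}$ with $\mathfrak{N}(\mathfrak{a})=n$ and $\alpha\in R$, $\alpha(\mathfrak{a})$ denotes the unique integer in $[0,n)$ with $\alpha-\alpha(\mathfrak{a})\in\mathfrak{a}$. A prime ideal $\mathfrak{p}$ of $R$ with $\mathfrak{p}\cap Z_\eta=pZ_\eta$ ($p$ prime) is ramified if $\mathfrak{p}^2$ divides $pR$, unramified otherwise. $(x,y)R$ denotes the ideal of $R$ generated by $x,y$. *)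

theory Defs
  imports "HOL-Computational_Algebra.Computational_Algebra" "Subresultants.Resultant_Prelim"
begin

definition is_subfield :: "complex set \<Rightarrow> bool" where
  "is_subfield L \<longleftrightarrow>
     0 \<in> L \<and> 1 \<in> L \<and>
     (\<forall>x\<in>L. \<forall>y\<in>L. x + y \<in> L \<and> x * y \<in> L) \<and>
     (\<forall>x\<in>L. - x \<in> L \<and> (x \<noteq> 0 \<longrightarrow> inverse x \<in> L))"

definition Q_adjoin :: "complex \<Rightarrow> complex set" where
  "Q_adjoin \<alpha> = \<Inter>{K. is_subfield K \<and> \<alpha> \<in> K}"

definition number_field :: "complex set \<Rightarrow> bool" where
  "number_field L \<longleftrightarrow> is_subfield L \<and>
     (\<exists>B. finite B \<and> B \<subseteq> L \<and>
        (\<forall>x\<in>L. \<exists>c. (\<forall>b\<in>B. c b \<in> \<rat>) \<and> x = (\<Sum>b\<in>B. c b * b)))"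

definition algebraic_integer :: "complex \<Rightarrow> bool" where
  "algebraic_integer x \<longleftrightarrow>
     (\<exists>p :: int poly. lead_coeff p = 1 \<and> poly (map_poly of_int p) x = 0)"

definition ring_of_integers :: "complex set \<Rightarrow> complex set" where
  "ring_of_integers L = {x \<in> L. algebraic_integer x}"

definition loc_ring :: "complex set \<Rightarrow> nat \<Rightarrow> complex set" where
  "loc_ring L \<eta> = {x. \<exists>y\<in>ring_of_integers L. \<exists>k::nat. x = y / of_nat (\<eta> ^ k)}"

definition Z_loc :: "nat \<Rightarrow> complex set" where
  "Z_loc \<eta> = {x. \<exists>m::int. \<exists>k::nat. x = of_int m / of_nat (\<eta> ^ k)}"

definition is_ideal :: "complex set \<Rightarrow> complex set \<Rightarrow> bool" where
  "is_ideal S I \<longleftrightarrow> I \<subseteq> S \<and> 0 \<in> I \<and>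
     (\<forall>x\<in>I. \<forall>y\<in>I. x + y \<in> I) \<and> (\<forall>r\<in>S. \<forall>x\<in>I. r * x \<in> I)"

definition prime_ideal :: "complex set \<Rightarrow> complex set \<Rightarrow> bool" where
  "prime_ideal S P \<longleftrightarrow> is_ideal S P \<and> P \<noteq> S \<and>
     (\<forall>x\<in>S. \<forall>y\<in>S. x * y \<in> P \<longrightarrow> x \<in> P \<or> y \<in> P)"

definition ideal_gen :: "complex set \<Rightarrow> complex set \<Rightarrow> complex set" where
  "ideal_gen S X = \<Inter>{I. is_ideal S I \<and> X \<subseteq> I}"

definition ideal_mult :: "complex set \<Rightarrow> complex set \<Rightarrow> complex set \<Rightarrow> complex set" where
  "ideal_mult S I J = ideal_gen S {x * y | x y. x \<in> I \<and> y \<in> J}"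

primrec ideal_pow :: "complex set \<Rightarrow> complex set \<Rightarrow> nat \<Rightarrow> complex set" where
  "ideal_pow S I 0 = S"
| "ideal_pow S I (Suc k) = ideal_mult S (ideal_pow S I k) I"

primrec ideal_factor_prod ::
  "complex set \<Rightarrow> (nat \<Rightarrow> complex set) \<Rightarrow> (nat \<Rightarrow> nat) \<Rightarrow> nat \<Rightarrow> complex set" where
  "ideal_factor_prod S P e 0 = S"
| "ideal_factor_prod S P e (Suc r) = ideal_mult S (ideal_factor_prod S P e r) (ideal_pow S (P r) (e r))"

definition ideal_dvd :: "complex set \<Rightarrow> complex set \<Rightarrow> complex set \<Rightarrow> bool" where
  "ideal_dvd S I J \<longleftrightarrow> (\<exists>K. is_ideal S K \<and> J = ideal_mult S I K)"

definition quot_card :: "complex set \<Rightarrow> complex set \<Rightarrow> nat" where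
  "quot_card S I = card ((\<lambda>x. {y \<in> S. x - y \<in> I}) ` S)"

definition abs_norm :: "complex set \<Rightarrow> nat \<Rightarrow> complex set \<Rightarrow> nat" where
  "abs_norm L \<eta> a = quot_card (loc_ring L \<eta>) a"

definition inertia_degree :: "complex set \<Rightarrow> nat \<Rightarrow> complex set \<Rightarrow> real" where
  "inertia_degree L \<eta> a =
     ln (real (quot_card (loc_ring L \<eta>) a)) / ln (real (quot_card (Z_loc \<eta>) (a \<inter> Z_loc \<eta>)))"

definition degree_one :: "complex set \<Rightarrow> nat \<Rightarrow> complex set \<Rightarrow> bool" where
  "degree_one L \<eta> a \<longleftrightarrow> inertia_degree L \<eta> a = 1"

definition ramified :: "complex set \<Rightarrow> nat \<Rightarrow> complex set \<Rightarrow> bool" where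
  "ramified L \<eta> P \<longleftrightarrow>
     (\<exists>p::nat. prime p \<and> P \<inter> Z_loc \<eta> = {of_nat p * z | z. z \<in> Z_loc \<eta>} \<and>
        ideal_dvd (loc_ring L \<eta>) (ideal_pow (loc_ring L \<eta>) P 2)
                  (ideal_gen (loc_ring L \<eta>) {of_nat p}))"

definition residue_of :: "complex set \<Rightarrow> nat \<Rightarrow> complex \<Rightarrow> complex set \<Rightarrow> int" where
  "residue_of L \<eta> \<alpha> a =
     (THE v::int. 0 \<le> v \<and> v < int (abs_norm L \<eta> a) \<and> \<alpha> - of_int v \<in> a)"

definition primitive_min_poly :: "complex \<Rightarrow> int poly \<Rightarrow> bool" where
  "primitive_min_poly \<alpha> f \<longleftrightarrow>
     f \<noteq> 0 \<and> poly (map_poly of_int f) \<alpha> = 0 \<and> content f = 1 \<and> lead_coeff f > 0 \<and>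
     (\<forall>g::int poly. g \<noteq> 0 \<and> poly (map_poly of_int g) \<alpha> = 0 \<longrightarrow> degree f \<le> degree g)"

definition poly_discriminant :: "int poly \<Rightarrow> int" where
  "poly_discriminant f =
     (-1) ^ (degree f * (degree f - 1) div 2) * (resultant f (pderiv f) div lead_coeff f)"

end

theory Submission
  imports Defs "Jordan_Normal_Form.Char_Poly"
begin

text \<open>
  A nonzero proper ideal $\mathfrak{a}$ of $R$ is of degree one iff $R = \mathbb{Z} + \mathfrak{a}$.
  This property passes to larger ideals and, by the Chinese remainder theorem, to products of ideals
  with coprime integer generators. For a prime $\mathfrak{p}$ of degree one over $p$, everything is
  governed by whether $p \in \mathfrak{p}^2$: if so, $\mathfrak{p}$ is ramified, and
  $R = \mathbb{Z} + \mathfrak{p}^2$ would give $\mathfrak{p} = \mathfrak{p}^2$; if not,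
  $\mathfrak{p} = pR + \mathfrak{p}^2$, and $R = \mathbb{Z} + \mathfrak{p}^k$ for all $k$.
  The only part of the theory of Dedekind domains that is needed is the invertibility of
  $\mathfrak{p}$, which follows from the finiteness of $R/nR$.

  For the second part, let $n \mid f(v)$. The discriminant hypothesis makes $f'(v)$ a unit modulo $n$,
  so $v$ lifts to roots $w$ of $f$ modulo arbitrarily high powers of $n$. If $y \in R$ and
  $n^s y = g(\alpha)$, then integrality of $y$ shows $n^s \mid g(w)$, and
  $y \mapsto g(w)/n^s$ is reduction modulo $(\alpha - v, n)R$, with values in $\mathbb{Z}/n$.
\<close>

subsection \<open>Algebraic integers\<close>

text \<open>\<open>R\<close> is handled as a bare set of complex numbers, without an integral basis,
  so every argument runs on elements. Let m be the positive generator of P intersected with the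
  integers. Finiteness of R/mR acts through the pigeonhole principle: powers of an element repeat
  modulo mR, which makes P maximal and produces u outside mR with uP inside mR. Then x = u/m is not
  in R, but xP is. If xP stayed inside P, all x ^ k * m would lie in P, and a repetition modulo mR
  would make x integral over R. Hence P + xP contains 1, and R + xR is the inverse of P; this single
  x carries every later use of invertibility. In the second part the obstacle is denominators: an
  element of R is a priori only a fraction g(\<alpha>) / (D * n ^ s) with D prime to n, and the
  value of g at v modulo n says nothing after division by n ^ s. Roots modulo n ^ (s + 1) restore
  the lost precision. They are used twice: to represent every residue modulo the ideal by an
  integer, and to show that all integers in the ideal are multiples of n.\<close>

context
begin

interpretation zspan: Modules.module "\<lambda>(n::int) (x::complex). of_int n * x"
  by unfold_locales (simp_all add: algebra_simps)

text \<open>The determinant trick: \<open>x\<close> is an eigenvalue of the integer matrix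
  \<open>c\<close>, whose characteristic polynomial is monic over the integers.\<close>

lemma algebraic_integer_of_eigenvector:
  fixes v :: "nat \<Rightarrow> complex" and c :: "nat \<Rightarrow> nat \<Rightarrow> int"
  assumes eq: "\<And>i. i < n \<Longrightarrow> x * v i = (\<Sum>j<n. of_int (c i j) * v j)"
    and k: "k < n" "v k \<noteq> 0"
  shows "algebraic_integer x"
proof -
  define A where "A = mat n n (\<lambda>(i,j). c i j)"
  define A' where "A' = map_mat (of_int :: int \<Rightarrow> complex) A"
  have A: "A \<in> carrier_mat n n" and A': "A' \<in> carrier_mat n n" by (auto simp: A_def A'_def)
  have "eigenvector A' (vec n v) x"
    unfolding eigenvector_def
  proof (intro conjI)
    show "vec n v \<in> carrier_vec (dim_row A')" using A' by auto
    show "vec n v \<noteq> 0\<^sub>v (dim_row A')"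
      using k A' by (metis carrier_matD(1) index_vec index_zero_vec(1))
    show "A' *\<^sub>v vec n v = x \<cdot>\<^sub>v vec n v"
    proof (rule eq_vecI)
      fix i assume "i < dim_vec (x \<cdot>\<^sub>v vec n v)"
      then have i: "i < n" by simp
      have "(A' *\<^sub>v vec n v) $ i = (\<Sum>j<n. of_int (c i j) * v j)"
        using i by (auto simp: A'_def A_def scalar_prod_def lessThan_atLeast0 intro!: sum.cong)
      then show "(A' *\<^sub>v vec n v) $ i = (x \<cdot>\<^sub>v vec n v) $ i"
        using i eq[OF i] by simp
    qed (use A' in auto)
  qed
  then have "poly (char_poly A') x = 0"
    using eigenvalue_root_char_poly[OF A'] eigenvalue_def by blast
  moreover have "char_poly A' = map_poly of_int (char_poly A)"
    unfolding A'_def by (rule of_int_hom.char_poly_hom[OF A])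
  moreover have "lead_coeff (char_poly A) = 1"
    using degree_monic_char_poly[OF A] by simp
  ultimately show ?thesis unfolding algebraic_integer_def by metis
qed

lemma algebraic_integer_of_stable_span:
  assumes "finite B" and "b \<in> B" "b \<noteq> 0" and st: "\<And>b. b \<in> B \<Longrightarrow> x * b \<in> zspan.span B"
  shows "algebraic_integer x"
proof -
  obtain v where v: "bij_betw v {0..<card B} B"
    using ex_bij_betw_nat_finite[OF \<open>finite B\<close>] by auto
  have "\<exists>c. x * v i = (\<Sum>j<card B. of_int (c j) * v j)" if "i < card B" for i
  proof -
    have "v i \<in> B" using v that by (auto simp: bij_betw_def)
    then obtain u where "x * v i = (\<Sum>b\<in>B. of_int (u b) * b)"
      using st[of "v i"] zspan.span_finite[OF \<open>finite B\<close>] by auto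
    also have "\<dots> = (\<Sum>j<card B. of_int (u (v j)) * v j)"
      using sum.reindex_bij_betw[OF v, of "\<lambda>b. of_int (u b) * b"] by (simp add: lessThan_atLeast0)
    finally show ?thesis by (intro exI[of _ "\<lambda>j. u (v j)"])
  qed
  then obtain c where c: "\<And>i. i < card B \<Longrightarrow> x * v i = (\<Sum>j<card B. of_int (c i j) * v j)"
    by metis
  obtain k where "k < card B" "v k = b"
    using bij_betw_imp_surj_on[OF v] \<open>b \<in> B\<close> by (metis atLeastLessThan_iff imageE)
  then show ?thesis using algebraic_integer_of_eigenvector[OF c] \<open>b \<noteq> 0\<close> by blast
qed

lemma mult_zspan:
  assumes "\<And>s. s \<in> S \<Longrightarrow> x * s \<in> zspan.span B" "y \<in> zspan.span S"
  shows "x * y \<in> zspan.span B"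
  using assms(2)
proof (induction rule: zspan.span_induct_alt)
  case base show ?case using zspan.span_zero by simp
next
  case (step c b y)
  have "x * (of_int c * b + y) = of_int c * (x * b) + x * y" by (simp add: algebra_simps)
  then show ?case using zspan.span_add[OF zspan.span_scale[OF assms(1)[OF step(1)]] step(2), of c]
    by simp
qed

lemma algebraic_integer_power_span:
  assumes "algebraic_integer x"
  obtains m where "m > 0" "x ^ m \<in> zspan.span ((\<lambda>i. x ^ i) ` {..<m})"
proof -
  obtain p :: "int poly" where p: "lead_coeff p = 1" "poly (map_poly of_int p) x = 0"
    using assms by (auto simp: algebraic_integer_def)
  define m where "m = degree p"
  have m: "m > 0"
  proof (rule ccontr)
    assume "\<not> m > 0"
    then obtain a where "p = [:a:]" using degree_eq_zeroE[of p] unfolding m_def by blast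
    then show False using p by simp
  qed
  have "(\<Sum>i\<le>m. of_int (coeff p i) * x ^ i) = 0"
    using p(2) by (simp add: poly_altdef m_def)
  moreover have "{..m} = insert m {..<m}" by auto
  ultimately have "x ^ m = - (\<Sum>i<m. of_int (coeff p i) * x ^ i)"
    using p(1) by (simp add: m_def add_eq_0_iff)
  also have "\<dots> = (\<Sum>i<m. of_int (- coeff p i) * x ^ i)" by (simp add: sum_negf)
  also have "\<dots> \<in> zspan.span ((\<lambda>i. x ^ i) ` {..<m})"
    by (intro zspan.span_sum zspan.span_scale zspan.span_base) auto
  finally show thesis using that[OF m] by blast
qed

text \<open>The products x ^ i * y ^ j below the degrees of the two monic equations span one module
  stable under both numbers, so sums and products share the same \<open>B\<close>. The element 1
  supplies a nonzero eigenvector entry.\<close>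

lemma algebraic_integer_stable_module:
  assumes "algebraic_integer x" "algebraic_integer y"
  obtains B where "finite B" "1 \<in> B"
    "\<And>b. b \<in> B \<Longrightarrow> x * b \<in> zspan.span B" "\<And>b. b \<in> B \<Longrightarrow> y * b \<in> zspan.span B"
proof -
  obtain m where m: "m > 0" "x ^ m \<in> zspan.span ((\<lambda>i. x ^ i) ` {..<m})"
    using algebraic_integer_power_span assms(1) by blast
  obtain n where n: "n > 0" "y ^ n \<in> zspan.span ((\<lambda>i. y ^ i) ` {..<n})"
    using algebraic_integer_power_span assms(2) by blast
  define B where "B = (\<lambda>(i,j). x ^ i * y ^ j) ` ({..<m} \<times> {..<n})"
  have B: "x ^ i * y ^ j \<in> zspan.span B" if "i < m" "j < n" for i j
    by (rule zspan.span_base) (use that in \<open>auto simp: B_def\<close>)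

  have X: "x * (x ^ i * y ^ j) \<in> zspan.span B" if "i < m" "j < n" for i j
  proof (cases "Suc i < m")
    case True
    then show ?thesis using B[of "Suc i" j] that by (simp add: mult.assoc)
  next
    \<comment> \<open>At the top exponent the product contains x ^ m, which the monic equation
      rewrites in lower powers.\<close>
    case False
    then have "Suc i = m" using that by simp
    then have "x * (x ^ i * y ^ j) = y ^ j * x ^ m" by (metis mult.assoc mult.commute power_Suc)
    moreover have "y ^ j * x ^ m \<in> zspan.span B"
      by (rule mult_zspan[OF _ m(2)]) (use B that in \<open>auto simp: mult.commute\<close>)
    ultimately show ?thesis by metis
  qed
  have Y: "y * (x ^ i * y ^ j) \<in> zspan.span B" if "i < m" "j < n" for i j
  proof (cases "Suc j < n")
    case True
    then show ?thesis using B[of i "Suc j"] that by (simp add: mult.left_commute)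
  next
    case False
    then have "Suc j = n" using that by simp
    then have "y * (x ^ i * y ^ j) = x ^ i * y ^ n" by (metis mult.left_commute power_Suc)
    moreover have "x ^ i * y ^ n \<in> zspan.span B"
      by (rule mult_zspan[OF _ n(2)]) (use B that in auto)
    ultimately show ?thesis by metis
  qed
  show thesis
  proof (rule that)
    show "finite B" by (simp add: B_def)
    have "x ^ 0 * y ^ 0 \<in> B" unfolding B_def using m(1) n(1) by (intro image_eqI[of _ _ "(0, 0)"]) auto
    then show "1 \<in> B" by simp
  qed (use X Y in \<open>auto simp: B_def\<close>)
qed

lemma algebraic_integer_add:
  assumes "algebraic_integer x" "algebraic_integer y"
  shows "algebraic_integer (x + y)"
proof -
  obtain B where B: "finite B" "1 \<in> B"
    "\<And>b. b \<in> B \<Longrightarrow> x * b \<in> zspan.span B" "\<And>b. b \<in> B \<Longrightarrow> y * b \<in> zspan.span B"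
    using algebraic_integer_stable_module[OF assms] by blast
  show ?thesis
    by (rule algebraic_integer_of_stable_span[OF B(1,2)])
       (use B zspan.span_add in \<open>auto simp: algebra_simps\<close>)
qed

lemma algebraic_integer_mult:
  assumes "algebraic_integer x" "algebraic_integer y"
  shows "algebraic_integer (x * y)"
proof -
  obtain B where B: "finite B" "1 \<in> B"
    "\<And>b. b \<in> B \<Longrightarrow> x * b \<in> zspan.span B" "\<And>b. b \<in> B \<Longrightarrow> y * b \<in> zspan.span B"
    using algebraic_integer_stable_module[OF assms] by blast
  show ?thesis
    by (rule algebraic_integer_of_stable_span[OF B(1,2)])
       (use B mult_zspan[of B x] in \<open>auto simp: mult.assoc\<close>)
qed

lemma algebraic_integer_of_int [simp]: "algebraic_integer (of_int n)"
  unfolding algebraic_integer_def by (rule exI[of _ "[:- n, 1:]"]) simp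

lemma poly_of_int_pcompose:
  fixes p q :: "int poly" and x :: "'a :: comm_ring_1"
  shows "poly (map_poly of_int (pcompose p q)) x = poly (map_poly of_int p) (poly (map_poly of_int q) x)"
  by (induction p) (simp_all add: pcompose_pCons of_int_hom.map_poly_pCons_hom hom_distribs)

text \<open>Substituting \<open>q\<close> into a monic equation for its value gives an equation for
  \<open>x\<close>, again monic because \<open>q\<close> is monic of positive degree.\<close>

lemma algebraic_integer_root:
  fixes q :: "int poly"
  assumes q: "lead_coeff q = 1" "degree q > 0"
    and "algebraic_integer (poly (map_poly of_int q) x)"
  shows "algebraic_integer x"
proof -
  obtain p :: "int poly" where p: "lead_coeff p = 1"
      "poly (map_poly of_int p) (poly (map_poly of_int q) x) = 0"
    using assms(3) by (auto simp: algebraic_integer_def)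
  have "lead_coeff (pcompose p q) = 1" using lead_coeff_comp[OF q(2), of p] unfolding p(1) q(1) by simp
  then show ?thesis using p(2) unfolding algebraic_integer_def poly_of_int_pcompose[symmetric] by blast
qed

text \<open>Stated over any field of characteristic 0 because it serves both complex matrix entries
  and coefficients of type \<open>rat\<close>.\<close>

lemma rational_common_denominator:
  fixes S :: "'a :: field_char_0 set"
  assumes "finite S" "S \<subseteq> \<rat>"
  shows "\<exists>D::int. D > 0 \<and> (\<forall>s\<in>S. of_int D * s \<in> \<int>)"
  using assms
proof (induction S)
  case empty show ?case by (intro exI[of _ 1]) simp
next
  case (insert s S)
  then obtain D where D: "D > 0" "\<forall>s\<in>S. of_int D * s \<in> \<int>" by auto
  obtain a b :: int where ab: "b > 0" "s = of_int a / of_int b"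
    using insert.prems by (auto elim: Rats_cases')
  have "of_int (b * D) * t \<in> \<int>" if "t \<in> S" for t :: 'a
  proof -
    have "of_int (b * D) * t = of_int b * (of_int D * t)" by simp
    then show ?thesis using D(2) that by (metis Ints_mult Ints_of_int)
  qed
  moreover have "of_int (b * D) * s = of_int (D * a)" using ab by simp
  then have "of_int (b * D) * s \<in> \<int>" by (metis Ints_of_int)
  ultimately show ?case using D(1) ab(1) by (intro exI[of _ "b * D"]) auto
qed

text \<open>Multiplication by \<open>x\<close> acts on the finite spanning set \<open>B\<close> by a
  rational matrix; clearing its denominators gives an integer matrix for a multiple of
  \<open>x\<close>. The eigenvector argument accepts any spanning family.\<close>

lemma number_field_denominator:
  assumes "number_field L" "x \<in> L"
  obtains D :: int where "D > 0" "algebraic_integer (of_int D * x)"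
proof -
  obtain B where B: "finite B" "B \<subseteq> L"
      "\<And>x. x \<in> L \<Longrightarrow> \<exists>c. (\<forall>b\<in>B. c b \<in> \<rat>) \<and> x = (\<Sum>b\<in>B. c b * b)"
    and L: "is_subfield L"
    using assms(1) unfolding number_field_def by blast
  have "1 \<in> L" and mult: "\<And>x y. x \<in> L \<Longrightarrow> y \<in> L \<Longrightarrow> x * y \<in> L" using L by (auto simp: is_subfield_def)
  obtain b where b: "b \<in> B" "b \<noteq> 0"
  proof -
    obtain u where u: "1 = (\<Sum>b\<in>B. u b * b)" using B(3)[OF \<open>1 \<in> L\<close>] by blast
    have "\<exists>b\<in>B. b \<noteq> 0"
    proof (rule ccontr)
      assume "\<not> (\<exists>b\<in>B. b \<noteq> 0)"
      then have "(\<Sum>b\<in>B. u b * b) = 0" by (intro sum.neutral) auto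
      then show False using u by simp
    qed
    then show thesis using that by blast
  qed
  have "\<forall>b\<in>B. \<exists>c. (\<forall>b'\<in>B. c b' \<in> \<rat>) \<and> x * b = (\<Sum>b'\<in>B. c b' * b')"
    using B mult[OF assms(2)] by blast
  then obtain c where c: "\<And>b b'. b \<in> B \<Longrightarrow> b' \<in> B \<Longrightarrow> c b b' \<in> \<rat>"
      "\<And>b. b \<in> B \<Longrightarrow> x * b = (\<Sum>b'\<in>B. c b b' * b')"
    by (subst (asm) bchoice_iff) auto
  from rational_common_denominator[of "(\<lambda>(b,b'). c b b') ` (B \<times> B)"] obtain D :: int where D: "D > 0"
      "\<And>b b'. b \<in> B \<Longrightarrow> b' \<in> B \<Longrightarrow> of_int D * c b b' \<in> \<int>"
    using B(1) c(1) by force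
  have "algebraic_integer (of_int D * x)"
  proof (rule algebraic_integer_of_stable_span[OF B(1) b])
    fix b assume b: "b \<in> B"
    have "of_int D * x * b = (\<Sum>b'\<in>B. (of_int D * c b b') * b')"
      using c(2)[OF b] by (simp add: mult.assoc sum_distrib_left)
    also have "\<dots> \<in> zspan.span B"
    proof (rule zspan.span_sum)
      fix b' assume b': "b' \<in> B"
      obtain k where "of_int D * c b b' = of_int k" using D(2)[OF b b'] by (auto elim: Ints_cases)
      then show "(of_int D * c b b') * b' \<in> zspan.span B"
        using zspan.span_scale[OF zspan.span_base[OF b'], of k] by simp
    qed
    finally show "of_int D * x * b \<in> zspan.span B" .
  qed
  then show thesis using that D(1) by blast
qed

end

subsection \<open>The ring $R$ and its ideals\<close>

lemma quot_card_transversal: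
  assumes T: "T \<subseteq> S" "\<And>x. x \<in> S \<Longrightarrow> \<exists>t\<in>T. x - t \<in> I"
      "\<And>t t'. t \<in> T \<Longrightarrow> t' \<in> T \<Longrightarrow> t - t' \<in> I \<Longrightarrow> t = t'"
    and I: "0 \<in> I" "\<And>x y. x \<in> I \<Longrightarrow> y \<in> I \<Longrightarrow> x - y \<in> I"
  shows "quot_card S I = card T"
proof -
  let ?c = "\<lambda>x. {y \<in> S. x - y \<in> I}"
  have eq: "?c x = ?c y" if "x - y \<in> I" for x y
  proof -
    have "x - z \<in> I \<longleftrightarrow> y - z \<in> I" for z
      using I(2)[of "x - z" "x - y"] I(2)[of "x - y" "x - z"] I(2)[OF I(1), of "z - y"]
        I(2)[OF that I(2)[OF I(1), of "y - z"]] that by auto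
    then show ?thesis by blast
  qed
  have "?c ` S = ?c ` T"
  proof
    show "?c ` S \<subseteq> ?c ` T" using T(2) eq by fastforce
    show "?c ` T \<subseteq> ?c ` S" using T(1) by blast
  qed
  moreover have "inj_on ?c T"
  proof (rule inj_onI)
    fix t t' assume t: "t \<in> T" "t' \<in> T" "?c t = ?c t'"
    have "t' \<in> ?c t'" using T(1) t(2) I(1) by auto
    then have "t' \<in> ?c t" using t(3) by simp
    then show "t = t'" using T(3)[OF t(1,2)] by simp
  qed
  ultimately show ?thesis by (simp add: quot_card_def card_image)
qed

lemma is_idealD:
  assumes "is_ideal S I"
  shows "I \<subseteq> S" "0 \<in> I" "\<And>x y. x \<in> I \<Longrightarrow> y \<in> I \<Longrightarrow> x + y \<in> I"
    "\<And>r x. r \<in> S \<Longrightarrow> x \<in> I \<Longrightarrow> r * x \<in> I"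
  using assms by (auto simp: is_ideal_def)

lemma ideal_gen_subset: "is_ideal S I \<Longrightarrow> X \<subseteq> I \<Longrightarrow> ideal_gen S X \<subseteq> I"
  by (auto simp: ideal_gen_def)

lemma subset_ideal_gen: "X \<subseteq> ideal_gen S X"
  by (auto simp: ideal_gen_def)

lemma mult_in_ideal_mult: "x \<in> I \<Longrightarrow> y \<in> J \<Longrightarrow> x * y \<in> ideal_mult S I J"
  unfolding ideal_mult_def using subset_ideal_gen[of "{x * y | x y. x \<in> I \<and> y \<in> J}" S] by blast

lemma ideal_mult_subset:
  "is_ideal S K \<Longrightarrow> (\<And>x y. x \<in> I \<Longrightarrow> y \<in> J \<Longrightarrow> x * y \<in> K) \<Longrightarrow> ideal_mult S I J \<subseteq> K"
  unfolding ideal_mult_def by (rule ideal_gen_subset) auto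

text \<open>Powers of X are divided out. The nonzero constant term later becomes a nonzero integer
  in an ideal, or the denominator of an inverse.\<close>

lemma nonzero_constant_coeff:
  fixes y :: complex
  assumes "y \<noteq> 0" "p \<noteq> 0" "poly (map_poly of_int p) y = 0"
  shows "\<exists>q :: int poly. coeff q 0 \<noteq> 0 \<and> poly (map_poly of_int q) y = 0"
  using assms(2,3)
proof (induction p)
  case (pCons a p)
  show ?case
  proof (cases "a = 0")
    case True
    then have "p \<noteq> 0" "poly (map_poly of_int p) y = 0"
      using pCons.prems assms(1) by (auto simp: of_int_hom.map_poly_pCons_hom)
    then show ?thesis using pCons.IH by blast
  next
    case False
    then show ?thesis using pCons.prems(2) by (intro exI[of _ "pCons a p"]) simp
  qed
qed simp

locale localized_integers =
  fixes L :: "complex set" and \<eta> :: nat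
  assumes number_field: "number_field L" and eta_pos: "\<eta> > 0"
begin

abbreviation R :: "complex set" where "R \<equiv> loc_ring L \<eta>"

lemma subfield: "is_subfield L"
  using number_field by (simp add: number_field_def)

lemma L_simps [simp]: "0 \<in> L" "1 \<in> L"
  and L_add: "x \<in> L \<Longrightarrow> y \<in> L \<Longrightarrow> x + y \<in> L" and L_mult: "x \<in> L \<Longrightarrow> y \<in> L \<Longrightarrow> x * y \<in> L"
  and L_uminus: "x \<in> L \<Longrightarrow> - x \<in> L"
  using subfield by (auto simp: is_subfield_def)

lemma L_divide: "x \<in> L \<Longrightarrow> y \<in> L \<Longrightarrow> x / y \<in> L"
  using subfield unfolding is_subfield_def divide_inverse
  by (cases "y = 0") auto

lemma L_of_nat [simp]: "of_nat n \<in> L"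
  by (induction n) (auto intro: L_add)

lemma L_of_int [simp]: "of_int n \<in> L"
  by (cases n) (auto intro: L_uminus simp del: of_nat_Suc)

lemma L_power: "x \<in> L \<Longrightarrow> x ^ k \<in> L"
  by (induction k) (auto intro: L_mult)

text \<open>Membership becomes clearing by a power of \<eta>, so that two elements can be brought to
  a common power and closure follows from that of the algebraic integers.\<close>

lemma R_iff: "x \<in> R \<longleftrightarrow> x \<in> L \<and> (\<exists>k. algebraic_integer (of_nat \<eta> ^ k * x))"
proof
  assume "x \<in> R"
  then obtain y k where "y \<in> L" "algebraic_integer y" "x = y / of_nat \<eta> ^ k"
    by (auto simp: loc_ring_def ring_of_integers_def)
  then show "x \<in> L \<and> (\<exists>k. algebraic_integer (of_nat \<eta> ^ k * x))"
    using eta_pos L_divide L_power by (auto intro!: exI[of _ k])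
next
  assume "x \<in> L \<and> (\<exists>k. algebraic_integer (of_nat \<eta> ^ k * x))"
  then obtain k where k: "x \<in> L" "algebraic_integer (of_nat \<eta> ^ k * x)" by blast
  then have "of_nat \<eta> ^ k * x \<in> ring_of_integers L"
    using L_mult[OF L_power[OF L_of_nat] k(1)] by (simp add: ring_of_integers_def)
  moreover have "x = of_nat \<eta> ^ k * x / of_nat (\<eta> ^ k)" using eta_pos by simp
  ultimately show "x \<in> R" unfolding loc_ring_def by blast
qed

lemma algebraic_integer_of_nat_power: "algebraic_integer (of_nat \<eta> ^ k)"
  using algebraic_integer_of_int[of "int \<eta> ^ k"] by simp

lemma R_add:
  assumes "x \<in> R" "y \<in> R" shows "x + y \<in> R"
proof -
  obtain k l where k: "algebraic_integer (of_nat \<eta> ^ k * x)" and l: "algebraic_integer (of_nat \<eta> ^ l * y)"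
    using assms R_iff by blast
  have "algebraic_integer (of_nat \<eta> ^ l * (of_nat \<eta> ^ k * x) + of_nat \<eta> ^ k * (of_nat \<eta> ^ l * y))"
    by (intro algebraic_integer_add algebraic_integer_mult k l algebraic_integer_of_nat_power)
  then have "algebraic_integer (of_nat \<eta> ^ (k + l) * (x + y))" by (simp add: algebra_simps power_add)
  then show ?thesis using assms R_iff L_add by blast
qed

lemma R_mult:
  assumes "x \<in> R" "y \<in> R" shows "x * y \<in> R"
proof -
  obtain k l where k: "algebraic_integer (of_nat \<eta> ^ k * x)" and l: "algebraic_integer (of_nat \<eta> ^ l * y)"
    using assms R_iff by blast
  have "algebraic_integer ((of_nat \<eta> ^ k * x) * (of_nat \<eta> ^ l * y))"
    by (intro algebraic_integer_mult k l)
  then have "algebraic_integer (of_nat \<eta> ^ (k + l) * (x * y))" by (simp add: algebra_simps power_add)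
  then show ?thesis using assms R_iff L_mult by blast
qed

lemma R_of_int [simp]: "of_int n \<in> R"
  unfolding R_iff by (auto intro!: exI[of _ 0])

lemma R_of_nat [simp]: "of_nat n \<in> R"
  using R_of_int[of "int n"] by simp

lemma R_simps [simp]: "0 \<in> R" "1 \<in> R"
  using R_of_int[of 0] R_of_int[of 1] by simp_all

lemma R_uminus: "x \<in> R \<Longrightarrow> - x \<in> R"
  using R_mult[OF R_of_int[of "-1"]] by simp

lemma R_diff: "x \<in> R \<Longrightarrow> y \<in> R \<Longrightarrow> x - y \<in> R"
  using R_add[OF _ R_uminus, of x y] by simp

lemma R_power: "x \<in> R \<Longrightarrow> x ^ k \<in> R"
  by (induction k) (auto intro: R_mult)

lemma R_subset_L: "x \<in> R \<Longrightarrow> x \<in> L"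
  by (simp add: R_iff)

lemma R_divide_eta:
  assumes "x \<in> R" shows "x / of_nat \<eta> ^ l \<in> R"
proof -
  obtain k where "algebraic_integer (of_nat \<eta> ^ k * x)" using assms R_iff by blast
  then have "algebraic_integer (of_nat \<eta> ^ (k + l) * (x / of_nat \<eta> ^ l))"
    using eta_pos by (simp add: power_add)
  then show ?thesis using assms R_iff L_divide L_power L_of_nat by blast
qed

lemma R_poly:
  fixes g :: "int poly"
  assumes "x \<in> R" shows "poly (map_poly of_int g) x \<in> R"
proof (induction g)
  case (pCons a g)
  then show ?case using assms by (auto intro: R_add R_mult simp: of_int_hom.map_poly_pCons_hom)
qed simp

text \<open>A substitute for integral closedness: equations of this shape come from the pigeonhole principle.\<close>

lemma R_integrally_closed:
  assumes "x \<in> L" "i < j" "x ^ j - x ^ i \<in> R"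
  shows "x \<in> R"
proof -
  obtain s where s: "algebraic_integer (of_nat \<eta> ^ s * (x ^ j - x ^ i))"
    using assms(3) R_iff by blast
  define y where "y = of_nat \<eta> ^ s * x"
  \<comment> \<open>Multiplying x ^ j - x ^ i by \<eta> ^ (s * j) turns it into the value of this
    monic integer polynomial at \<open>y\<close>.\<close>
  define q where "q = monom 1 j - monom (int \<eta> ^ (s * (j - i))) i"
  have "degree (monom (int \<eta> ^ (s * (j - i))) i) < j"
    using degree_monom_le assms(2) by (rule le_less_trans)
  then have deg: "degree q = j"
    unfolding q_def using degree_add_eq_left[of "- monom (int \<eta> ^ (s * (j - i))) i" "monom 1 j"]
    by (simp add: degree_monom_eq)
  have lc: "lead_coeff q = 1"
    unfolding deg using assms(2) by (simp add: q_def)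
  have "poly (map_poly of_int q) y = y ^ j - of_nat \<eta> ^ (s * (j - i)) * y ^ i"
    by (simp add: q_def hom_distribs poly_monom)
  also have "\<dots> = of_nat \<eta> ^ (s * j) * (x ^ j - x ^ i)"
  proof -
    have "s * j = s * (j - i) + s * i" using assms(2) by (metis add_mult_distrib2 le_add_diff_inverse2 less_imp_le)
    then have "(of_nat \<eta> :: complex) ^ (s * j) = of_nat \<eta> ^ (s * (j - i)) * of_nat \<eta> ^ (s * i)"
      by (metis power_add)
    then show ?thesis unfolding y_def power_mult_distrib power_mult[symmetric] right_diff_distrib
      by (simp add: mult.assoc)
  qed
  \<comment> \<open>Since j > 0, a factor \<eta> ^ s can be split off; it makes x ^ j - x ^ i
    integral, and the remaining factor is an integer.\<close>
  also have "\<dots> = of_nat \<eta> ^ (s * (j - 1)) * (of_nat \<eta> ^ s * (x ^ j - x ^ i))"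
  proof -
    have "s * j = s * (j - 1) + s" using assms(2) by (cases j) auto
    then show ?thesis by (simp add: power_add)
  qed
  finally have "algebraic_integer (poly (map_poly of_int q) y)"
    using algebraic_integer_mult[OF algebraic_integer_of_nat_power s] by simp
  moreover have "degree q > 0" using deg assms(2) by simp
  ultimately have "algebraic_integer y" using algebraic_integer_root[OF lc] by blast
  then show ?thesis using assms(1) R_iff y_def by blast
qed

lemma ideal_uminus: "is_ideal R I \<Longrightarrow> x \<in> I \<Longrightarrow> - x \<in> I"
  using is_idealD(4)[of R I "-1" x] R_of_int[of "-1"] by simp

lemma ideal_diff: "is_ideal R I \<Longrightarrow> x \<in> I \<Longrightarrow> y \<in> I \<Longrightarrow> x - y \<in> I"
  using is_idealD(3)[of R I x "- y"] ideal_uminus[of I y] by simp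

lemma ideal_mult_right: "is_ideal R I \<Longrightarrow> x \<in> I \<Longrightarrow> r \<in> R \<Longrightarrow> x * r \<in> I"
  using is_idealD(4)[of R I r x] by (simp add: mult.commute)

lemma is_ideal_R: "is_ideal R R"
  by (auto simp: is_ideal_def intro: R_add R_mult)

lemma is_ideal_principal: 
  assumes "c \<in> R" shows "is_ideal R {c * r | r. r \<in> R}"
  unfolding is_ideal_def
proof (intro conjI ballI)
  show "{c * r |r. r \<in> R} \<subseteq> R" using R_mult assms by auto
  show "0 \<in> {c * r |r. r \<in> R}" using R_simps by force
  fix x assume "x \<in> {c * r |r. r \<in> R}"
  then obtain r where r: "r \<in> R" "x = c * r" by auto
  {
    fix y assume "y \<in> {c * r |r. r \<in> R}"
    then obtain s where "s \<in> R" "y = c * s" by auto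
    then have "x + y = c * (r + s)" "r + s \<in> R" using r R_add by (auto simp: algebra_simps)
    then show "x + y \<in> {c * r |r. r \<in> R}" by auto
  next
    fix s assume "s \<in> R"
    then have "s * x = c * (s * r)" "s * r \<in> R" using r R_mult by auto
    then show "s * x \<in> {c * r |r. r \<in> R}" by auto
  }
qed

lemma is_ideal_gen: "X \<subseteq> R \<Longrightarrow> is_ideal R (ideal_gen R X)"
  using is_ideal_R unfolding ideal_gen_def is_ideal_def by (auto; blast)

lemma is_ideal_mult:
  assumes "is_ideal R I" "is_ideal R J" shows "is_ideal R (ideal_mult R I J)"
  unfolding ideal_mult_def
  by (rule is_ideal_gen) (use assms is_idealD(1) R_mult in blast)

lemma ideal_gen_singleton:
  assumes "c \<in> R" shows "ideal_gen R {c} = {c * r | r. r \<in> R}"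
proof
  show "ideal_gen R {c} \<subseteq> {c * r | r. r \<in> R}"
    by (rule ideal_gen_subset[OF is_ideal_principal[OF assms]]) (use R_simps in force)
  show "{c * r | r. r \<in> R} \<subseteq> ideal_gen R {c}"
    using ideal_mult_right[OF is_ideal_gen, of "{c}" c] subset_ideal_gen[of "{c}" R] assms by auto
qed

lemma ideal_mult_subset_left: "is_ideal R I \<Longrightarrow> is_ideal R J \<Longrightarrow> ideal_mult R I J \<subseteq> I"
  by (rule ideal_mult_subset) (use is_idealD(1) ideal_mult_right in blast)+

lemma ideal_mult_subset_right: "is_ideal R I \<Longrightarrow> is_ideal R J \<Longrightarrow> ideal_mult R I J \<subseteq> J"
  by (rule ideal_mult_subset) (use is_idealD in blast)+

lemma ideal_one_imp_R: "is_ideal R I \<Longrightarrow> 1 \<in> I \<Longrightarrow> I = R"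
  using is_idealD(1,4)[of R I] by force

text \<open>If \<open>y\<close> is a root of an integer polynomial, the constant term of that
  polynomial is a multiple of \<open>y\<close>.\<close>

lemma nonzero_ideal_has_int:
  assumes I: "is_ideal R I" "I \<noteq> {0}"
  shows "\<exists>n::int. n > 0 \<and> of_int n \<in> I"
proof -
  obtain x where x: "x \<in> I" "x \<noteq> 0" using I is_idealD(2) by blast
  then obtain k where k: "algebraic_integer (of_nat \<eta> ^ k * x)" using I(1) is_idealD(1) R_iff by blast
  define y where "y = of_nat \<eta> ^ k * x"
  have "of_int (int \<eta> ^ k) * x \<in> I" by (intro is_idealD(4)[OF I(1)] R_of_int x)
  then have y: "y \<in> I" "y \<noteq> 0" using x eta_pos by (simp_all add: y_def)
  obtain p :: "int poly" where "p \<noteq> 0" "poly (map_poly of_int p) y = 0"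
    using k unfolding algebraic_integer_def y_def[symmetric] by (metis leading_coeff_0_iff zero_neq_one)
  then obtain q :: "int poly" where q: "coeff q 0 \<noteq> 0" "poly (map_poly of_int q) y = 0"
    using nonzero_constant_coeff y(2) by blast
  obtain a q' where "q = pCons a q'" by (cases q)
  then have a: "a \<noteq> 0" "of_int a = - (y * poly (map_poly of_int q') y)"
    using q by (auto simp: of_int_hom.map_poly_pCons_hom add_eq_0_iff2)
  have "y * poly (map_poly of_int q') y \<in> I"
    using ideal_mult_right[OF I(1) y(1)] R_poly is_idealD(1)[OF I(1)] y(1) by blast
  then have "of_int a \<in> I" "of_int (- a) \<in> I" using a(2) ideal_uminus[OF I(1)] by auto
  then show ?thesis using a(1) by (metis linorder_neqE_linordered_idom neg_0_less_iff_less)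
qed

lemma ideal_int_mult: "is_ideal R I \<Longrightarrow> of_int m \<in> I \<Longrightarrow> m dvd z \<Longrightarrow> of_int z \<in> I"
  using ideal_mult_right[of I "of_int m"] by (auto elim!: dvdE)

text \<open>The positive generator of $I \cap \mathbb{Z}$; it is prime to $\eta$ because $\eta$ is a unit of $R$.\<close>

definition int_gen :: "complex set \<Rightarrow> int" where
  "int_gen I = int (LEAST n. n > 0 \<and> of_nat n \<in> I)"

section \<open>Integers in an ideal and the degree one criterion\<close>

context
  fixes I :: "complex set"
  assumes I: "is_ideal R I" "I \<noteq> {0}"
begin

lemma int_gen_pos: "int_gen I > 0"
  and int_gen_in: "of_int (int_gen I) \<in> I"
  and int_gen_least: "0 < z \<Longrightarrow> of_int z \<in> I \<Longrightarrow> int_gen I \<le> z"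
proof -
  let ?P = "\<lambda>n. n > 0 \<and> (of_nat n :: complex) \<in> I"
  obtain n :: int where "n > 0" "of_int n \<in> I" using nonzero_ideal_has_int[OF I] by blast
  then have "?P (nat n)" by simp
  from LeastI[of ?P, OF this] show "int_gen I > 0" "of_int (int_gen I) \<in> I"
    by (auto simp: int_gen_def)
  assume z: "0 < z" "of_int z \<in> I"
  then have "?P (nat z)" by simp
  from Least_le[of ?P, OF this] show "int_gen I \<le> z" using z by (simp add: int_gen_def nat_le_iff le_nat_iff)
qed

lemma of_int_in_ideal_iff: "of_int z \<in> I \<longleftrightarrow> int_gen I dvd z"
proof
  assume z: "of_int z \<in> I"
  have "of_int (int_gen I * (z div int_gen I)) \<in> I"
    using ideal_int_mult[OF I(1) int_gen_in] dvd_triv_left by blast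
  then have "of_int (z - int_gen I * (z div int_gen I)) \<in> I"
    using ideal_diff[OF I(1) z] unfolding of_int_diff by blast
  then have "of_int (z mod int_gen I) \<in> I" by (simp add: minus_mult_div_eq_mod)
  then show "int_gen I dvd z"
    using int_gen_least[of "z mod int_gen I"] int_gen_pos
    by (metis dvd_eq_mod_eq_0 leD pos_mod_bound pos_mod_sign order_le_less)
qed (use ideal_int_mult[OF I(1) int_gen_in] in blast)

lemma coprime_int_gen: "coprime (int_gen I) (int \<eta>)"
proof (rule coprimeI)
  fix c assume c: "c dvd int_gen I" "c dvd int \<eta>"
  then obtain m k where mk: "int_gen I = c * m" "int \<eta> = c * k" by (auto elim!: dvdE)
  have ceta: "(of_nat \<eta> :: complex) = of_int c * of_int k" using mk(2)
    by (metis of_int_mult of_int_of_nat_eq)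
  \<comment> \<open>Since \<eta> = c * k, this element is \<open>int_gen I\<close> divided by
    \<open>c\<close>. Its membership in \<open>I\<close> makes \<open>int_gen I\<close> divide the
    quotient \<open>m\<close>, so \<open>c\<close> is a unit.\<close>
  have "of_int (int_gen I) * (of_int k / of_nat \<eta> ^ 1) \<in> I"
    by (intro ideal_mult_right[OF I(1) int_gen_in] R_divide_eta R_of_int)
  moreover have "of_int (int_gen I) * (of_int k / of_nat \<eta> ^ 1) = (of_int m :: complex)"
  proof -
    have "(of_int c :: complex) \<noteq> 0" "(of_int k :: complex) \<noteq> 0" using ceta eta_pos by auto
    then show ?thesis unfolding mk(1) ceta by simp
  qed
  ultimately have "int_gen I dvd m" using of_int_in_ideal_iff by simp
  then show "is_unit c" using mk(1) int_gen_pos by auto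
qed

text \<open>Powers of \<eta> are invertible modulo \<open>int_gen I\<close>: the Bezout coefficient
  \<open>v\<close> stands in for 1 / \<eta> ^ k.\<close>

lemma Z_loc_cong_int:
  assumes "x \<in> Z_loc \<eta>" obtains z :: int where "x - of_int z \<in> I \<inter> Z_loc \<eta>"
proof -
  obtain a k where x: "x = of_int a / of_nat (\<eta> ^ k)" using assms by (auto simp: Z_loc_def)
  have "coprime (int_gen I) (int \<eta> ^ k)" using coprime_int_gen by simp
  then obtain u v where uv: "u * int_gen I + v * (int \<eta> ^ k) = 1"
    using bezout_int[of "int_gen I" "int \<eta> ^ k"] by auto
  define w where "w = a * u * int_gen I"
  have "a = a * (u * int_gen I + v * int \<eta> ^ k)" unfolding uv by simp
  also have "\<dots> = w + a * v * int \<eta> ^ k" by (simp add: w_def distrib_left mult.assoc)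
  finally have "(of_int a :: complex) = of_int (w + a * v * int \<eta> ^ k)" by (rule arg_cong)
  then have "x = of_int (w + a * v * int \<eta> ^ k) / of_nat (\<eta> ^ k)" using x by metis
  then have eq: "x - of_int (a * v) = of_int w / of_nat (\<eta> ^ k)"
    using eta_pos by (simp add: add_divide_distrib)
  also have "\<dots> = of_int (int_gen I) * (of_int (a * u) / of_nat \<eta> ^ k)" by (simp add: w_def)
  finally have "x - of_int (a * v) \<in> I"
    using ideal_mult_right[OF I(1) int_gen_in R_divide_eta[OF R_of_int]] by metis
  moreover have "x - of_int (a * v) \<in> Z_loc \<eta>" unfolding eq Z_loc_def by blast
  ultimately show thesis using that by blast
qed

lemma Z_loc_diff:
  assumes "x \<in> Z_loc \<eta>" "y \<in> Z_loc \<eta>" shows "x - y \<in> Z_loc \<eta>"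
proof -
  obtain a k b l where "x = of_int a / of_nat (\<eta> ^ k)" "y = of_int b / of_nat (\<eta> ^ l)"
    using assms by (auto simp: Z_loc_def)
  then have "x - y = of_int (a * int (\<eta> ^ l) - b * int (\<eta> ^ k)) / of_nat (\<eta> ^ (k + l))"
    using eta_pos by (simp add: diff_divide_distrib power_add)
  then show ?thesis unfolding Z_loc_def by blast
qed

lemma of_int_Z_loc: "of_int z \<in> Z_loc \<eta>"
  unfolding Z_loc_def by (auto intro!: exI[of _ z] exI[of _ "0::nat"])

lemma int_cong_reduced: "\<exists>t\<in>of_int ` {0..<int_gen I}. of_int z - t \<in> I"
proof
  have "int_gen I dvd z - z mod int_gen I" by (simp add: mod_eq_dvd_iff[symmetric])
  then show "of_int z - of_int (z mod int_gen I) \<in> I"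
    using of_int_in_ideal_iff[of "z - z mod int_gen I"] by simp
qed (use int_gen_pos in simp)

lemma int_reduced_unique:
  assumes "t \<in> of_int ` {0..<int_gen I}" "t' \<in> of_int ` {0..<int_gen I}" "t - t' \<in> I"
  shows "t = t'"
proof -
  obtain a b where ab: "t = of_int a" "t' = of_int b" "a \<in> {0..<int_gen I}" "b \<in> {0..<int_gen I}"
    using assms(1,2) by auto
  then have "int_gen I dvd a - b" using assms(3) of_int_in_ideal_iff[of "a - b"] by simp
  then have "a mod int_gen I = b mod int_gen I" by (simp add: mod_eq_dvd_iff)
  then show ?thesis using ab by simp
qed

lemma card_reduced_ints: "card ((of_int :: int \<Rightarrow> complex) ` {0..<int_gen I}) = nat (int_gen I)"
  by (subst card_image) (auto simp: inj_on_def)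

text \<open>Identifies the denominator of \<open>inertia_degree\<close> as the logarithm of
  \<open>int_gen I\<close>.\<close>

lemma quot_card_Z_loc: "quot_card (Z_loc \<eta>) (I \<inter> Z_loc \<eta>) = nat (int_gen I)"
proof -
  have "quot_card (Z_loc \<eta>) (I \<inter> Z_loc \<eta>) = card ((of_int :: int \<Rightarrow> complex) ` {0..<int_gen I})"
  proof (rule quot_card_transversal)
    fix x assume x: "x \<in> Z_loc \<eta>"
    obtain z where z: "x - of_int z \<in> I \<inter> Z_loc \<eta>" using Z_loc_cong_int[OF x] by blast
    obtain t where t: "t \<in> of_int ` {0..<int_gen I}" "of_int z - t \<in> I" using int_cong_reduced by blast
    have "x - t \<in> I" using is_idealD(3)[OF I(1), of "x - of_int z" "of_int z - t"] z t(2) by simp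
    moreover have "x - t \<in> Z_loc \<eta>" using t(1) x Z_loc_diff of_int_Z_loc by auto
    ultimately show "\<exists>t\<in>of_int ` {0..<int_gen I}. x - t \<in> I \<inter> Z_loc \<eta>" using t(1) by blast
  qed (use of_int_Z_loc is_idealD(2)[OF I(1)] of_int_Z_loc[of 0] int_reduced_unique
        ideal_diff[OF I(1)] Z_loc_diff in auto)
  then show ?thesis using card_reduced_ints by simp
qed

text \<open>Puts the generator into the shape that \<open>ramified\<close> asks of its
  prime.\<close>

lemma ideal_Int_Z_loc: "I \<inter> Z_loc \<eta> = {of_int (int_gen I) * z | z. z \<in> Z_loc \<eta>}"
proof (intro subset_antisym subsetI)
  fix x assume x: "x \<in> I \<inter> Z_loc \<eta>"
  then obtain a k where ak: "x = of_int a / of_nat (\<eta> ^ k)" by (auto simp: Z_loc_def)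
  then have "of_int a = of_int (int \<eta> ^ k) * x" using eta_pos by simp
  moreover have "of_int (int \<eta> ^ k) * x \<in> I" using is_idealD(4)[OF I(1) R_of_int] x by blast
  ultimately have "int_gen I dvd a" using of_int_in_ideal_iff by metis
  then obtain b where "a = int_gen I * b" by blast
  then have "x = of_int (int_gen I) * (of_int b / of_nat (\<eta> ^ k))" using ak by simp
  then show "x \<in> {of_int (int_gen I) * z | z. z \<in> Z_loc \<eta>}" unfolding Z_loc_def by blast
next
  fix x assume "x \<in> {of_int (int_gen I) * z | z. z \<in> Z_loc \<eta>}"
  then obtain a k where ak: "x = of_int (int_gen I) * (of_int a / of_nat (\<eta> ^ k))"
    by (auto simp: Z_loc_def)
  then have "x \<in> I"
    using ideal_mult_right[OF I(1) int_gen_in R_divide_eta[OF R_of_int]] by auto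
  moreover have "x = of_int (int_gen I * a) / of_nat (\<eta> ^ k)" using ak by simp
  then have "x \<in> Z_loc \<eta>" unfolding Z_loc_def by blast
  ultimately show "x \<in> I \<inter> Z_loc \<eta>" by blast
qed

lemma abs_norm_eq_int_gen:
  assumes "\<And>x. x \<in> R \<Longrightarrow> \<exists>z::int. x - of_int z \<in> I"
  shows "int (abs_norm L \<eta> I) = int_gen I"
proof -
  have "quot_card R I = card ((of_int :: int \<Rightarrow> complex) ` {0..<int_gen I})"
  proof (rule quot_card_transversal)
    fix x assume "x \<in> R"
    then obtain z :: int where z: "x - of_int z \<in> I" using assms by blast
    obtain t where t: "t \<in> of_int ` {0..<int_gen I}" "of_int z - t \<in> I" using int_cong_reduced by blast
    have "x - t \<in> I" using is_idealD(3)[OF I(1), of "x - of_int z" "of_int z - t"] z t(2) by simp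
    then show "\<exists>t\<in>of_int ` {0..<int_gen I}. x - t \<in> I" using t(1) by blast
  qed (use is_idealD(2)[OF I(1)] int_reduced_unique ideal_diff[OF I(1)] in auto)
  then show ?thesis using card_reduced_ints int_gen_pos by (simp add: abs_norm_def)
qed

text \<open>The integers below \<open>int_gen I\<close> are always pairwise incongruent modulo
  \<open>I\<close>, so equality of the logarithms says that their classes exhaust a finite
  quotient.\<close>

lemma degree_one_iff:
  assumes "I \<noteq> R"
  shows "degree_one L \<eta> I \<longleftrightarrow> (\<forall>x\<in>R. \<exists>z::int. x - of_int z \<in> I)"
proof -
  \<comment> \<open>Properness excludes \<open>int_gen I\<close> = 1, whose logarithm 0 would be a
    denominator.\<close>
  have m: "int_gen I \<ge> 2"
    using assms ideal_one_imp_R[OF I(1)] int_gen_in int_gen_pos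
    by (metis of_int_1 int_one_le_iff_zero_less order_le_less one_add_one zless_imp_add1_zle)
  let ?T = "(of_int :: int \<Rightarrow> complex) ` {0..<int_gen I}"
  let ?c = "\<lambda>x. {y \<in> R. x - y \<in> I}"
  let ?N = "quot_card R I"
  show ?thesis
  proof
    assume "\<forall>x\<in>R. \<exists>z::int. x - of_int z \<in> I"
    then have "?N = nat (int_gen I)" using abs_norm_eq_int_gen by (auto simp: abs_norm_def)
    then show "degree_one L \<eta> I"
      using m by (simp add: degree_one_def inertia_degree_def quot_card_Z_loc)
  next
    assume "degree_one L \<eta> I"
    moreover have "real (nat (int_gen I)) = real_of_int (int_gen I)" using m by simp
    ultimately have "ln (real ?N) / ln (real_of_int (int_gen I)) = 1"
      by (simp only: degree_one_def inertia_degree_def quot_card_Z_loc)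
    moreover have lnm: "ln (real_of_int (int_gen I)) \<noteq> 0"
      using m ln_gt_zero[of "real_of_int (int_gen I)"] by linarith
    ultimately have ln: "ln (real ?N) = ln (real_of_int (int_gen I))" by (metis divide_eq_1_iff)
    \<comment> \<open>An infinite quotient has \<open>card\<close> 0, and ln 0 = 0 would contradict
      \<open>lnm\<close>.\<close>
    then have "?N > 0" using lnm by (cases "?N = 0") auto
    then have "real ?N = real_of_int (int_gen I)" using ln m ln_inj_iff[of "real ?N" "real_of_int (int_gen I)"] by simp
    then have N: "?N = nat (int_gen I)" by linarith
    then have card: "card (?c ` R) = card ?T" using card_reduced_ints by (simp add: quot_card_def)
    have "inj_on ?c ?T"
    proof (rule inj_onI)
      fix t t' assume t: "t \<in> ?T" "t' \<in> ?T" "?c t = ?c t'"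
      have "t' \<in> ?c t'" using is_idealD(2)[OF I(1)] t(2) by auto
      then have "t - t' \<in> I" unfolding t(3)[symmetric] by simp
      then show "t = t'" using int_reduced_unique t(1,2) by blast
    qed
    then have "card (?c ` ?T) = card (?c ` R)" using card by (simp add: card_image)
    moreover have "?c ` ?T \<subseteq> ?c ` R" by auto
    moreover have "finite (?c ` R)"
      using \<open>?N > 0\<close> unfolding quot_card_def by (rule card_ge_0_finite)
    ultimately have eq: "?c ` R = ?c ` ?T"
      by (intro card_subset_eq[symmetric]) auto
    show "\<forall>x\<in>R. \<exists>z::int. x - of_int z \<in> I"
    proof
      fix x assume x: "x \<in> R"
      have "?c x \<in> ?c ` ?T" unfolding eq[symmetric] using x by (rule imageI)
      then obtain t where t: "?c x = ?c t" "t \<in> ?T" by (rule imageE)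
      have "t \<in> ?c t" using is_idealD(2)[OF I(1)] t(2) by auto
      then have "x - t \<in> I" unfolding t(1)[symmetric] by simp
      then show "\<exists>z::int. x - of_int z \<in> I" using t(2) by auto
    qed
  qed
qed

end

end

subsection \<open>Finiteness of $R/nR$\<close>

context localized_integers
begin

text \<open>The bound is the size of a finite rational spanning set of \<open>L\<close>: larger sets
  are dependent over the rationals, and a common denominator makes the relation integral.\<close>

lemma integer_relation_of_large_card:
  obtains d where "\<And>S. finite S \<Longrightarrow> S \<subseteq> L \<Longrightarrow> card S > d \<Longrightarrow>
    \<exists>c :: complex \<Rightarrow> int. (\<exists>s\<in>S. c s \<noteq> 0) \<and> (\<Sum>s\<in>S. of_int (c s) * s) = 0"
proof -
  interpret qspan: vector_space "\<lambda>(q::rat) (x::complex). of_rat q * x"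
    by unfold_locales (simp_all add: algebra_simps of_rat_add of_rat_mult)
  obtain B where B: "finite B" "\<And>x. x \<in> L \<Longrightarrow> \<exists>c. (\<forall>b\<in>B. c b \<in> \<rat>) \<and> x = (\<Sum>b\<in>B. c b * b)"
    using number_field unfolding number_field_def by blast
  have span: "L \<subseteq> qspan.span B"
  proof
    fix x assume "x \<in> L"
    then obtain c where c: "\<forall>b\<in>B. c b \<in> \<rat>" "x = (\<Sum>b\<in>B. c b * b)" using B(2) by blast
    have "c b * b \<in> qspan.span B" if b: "b \<in> B" for b
    proof -
      obtain q where "c b = of_rat q" using c(1) b by (auto elim: Rats_cases)
      then show ?thesis using qspan.span_scale[OF qspan.span_base[OF b], of q] by simp
    qed
    then show "x \<in> qspan.span B" unfolding c(2) by (rule qspan.span_sum)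
  qed
  show thesis
  proof (rule that)
    fix S :: "complex set" assume S: "finite S" "S \<subseteq> L" "card S > card B"
    then have "qspan.dependent S"
      using qspan.independent_span_bound[OF B(1), of S] span by force
    then obtain u where u: "\<exists>v\<in>S. u v \<noteq> 0" "(\<Sum>v\<in>S. of_rat (u v) * v) = 0"
      using qspan.dependent_finite[OF S(1)] by auto
    obtain D :: int where D: "D > 0" "\<And>s. s \<in> S \<Longrightarrow> of_int D * u s \<in> \<int>"
      using rational_common_denominator[of "u ` S"] S(1) by (auto simp: Rats_def)
    then have "\<forall>s\<in>S. \<exists>k. of_int D * u s = of_int k" by (blast elim: Ints_cases)
    then obtain c where c: "\<And>s. s \<in> S \<Longrightarrow> of_int D * u s = of_int (c s)" by metis
    have "(\<Sum>s\<in>S. of_int (c s) * s) = of_int D * (\<Sum>s\<in>S. of_rat (u s) * s)"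
      unfolding sum_distrib_left
    proof (rule sum.cong)
      fix s assume "s \<in> S"
      have "(of_int (c s) :: complex) = of_rat (of_int (c s))" by simp
      also have "\<dots> = of_int D * of_rat (u s)" unfolding c[OF \<open>s \<in> S\<close>, symmetric] by (simp add: of_rat_mult)
      finally show "of_int (c s) * s = of_int D * (of_rat (u s) * s)" by simp
    qed simp
    then show "\<exists>c :: complex \<Rightarrow> int. (\<exists>s\<in>S. c s \<noteq> 0) \<and> (\<Sum>s\<in>S. of_int (c s) * s) = 0"
      using u c D(1) by (intro exI[of _ c]) force
  qed
qed

text \<open>Dividing a rational relation by its content keeps it nontrivial modulo $p$, so that
  the rank of $R/pR$ is bounded by the degree of $L$ without any knowledge of an integral basis.\<close>

lemma finite_residues_prime:
  fixes p :: nat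
  assumes "prime p"
  shows "\<exists>T. finite T \<and> (\<forall>x\<in>R. \<exists>t\<in>T. x - t \<in> {of_nat p * r | r. r \<in> R})"
proof -
  define K where "K = {of_nat p * r | r. r \<in> R}"
  have K: "is_ideal R K" unfolding K_def using is_ideal_principal by simp
  have pK: "of_int (int p * k) * r \<in> K" if "r \<in> R" for k r
    unfolding K_def using R_mult[OF R_of_int[of k] that] by (auto simp: mult.assoc)
  obtain d where d: "\<And>S. finite S \<Longrightarrow> S \<subseteq> L \<Longrightarrow> card S > d \<Longrightarrow>
      \<exists>c :: complex \<Rightarrow> int. (\<exists>s\<in>S. c s \<noteq> 0) \<and> (\<Sum>s\<in>S. of_int (c s) * s) = 0"
    using integer_relation_of_large_card by blast
  \<comment> \<open>Linear independence in R/pR over the field with p elements, phrased with integer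
    coefficients.\<close>
  define indep where "indep S \<longleftrightarrow> finite S \<and> S \<subseteq> R \<and>
      (\<forall>c :: complex \<Rightarrow> int. (\<Sum>s\<in>S. of_int (c s) * s) \<in> K \<longrightarrow> (\<forall>s\<in>S. int p dvd c s))" for S
  have bound: "card S \<le> d" if S: "indep S" for S
  proof (rule ccontr)
    assume "\<not> card S \<le> d"
    moreover have fin: "finite S" and "S \<subseteq> L" using S R_subset_L by (auto simp: indep_def)
    ultimately obtain c :: "complex \<Rightarrow> int" where c: "\<exists>s\<in>S. c s \<noteq> 0" "(\<Sum>s\<in>S. of_int (c s) * s) = 0"
      using d[of S] unfolding not_le by blast
    define g where "g = Gcd (c ` S)"
    have g: "g \<noteq> 0" using c(1) by (auto simp: g_def)
    have gc: "c s = g * (c s div g)" if "s \<in> S" for s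
      using that by (simp add: g_def Gcd_dvd)
    have "of_int g * (\<Sum>s\<in>S. of_int (c s div g) * s) = (\<Sum>s\<in>S. of_int (c s) * s)"
      unfolding sum_distrib_left using gc by (intro sum.cong) (auto simp: mult.assoc[symmetric] simp flip: of_int_mult)
    then have "(\<Sum>s\<in>S. of_int (c s div g) * s) = 0" using c(2) g by simp
    \<comment> \<open>Independence applied to the divided relation: p * g then divides every
      coefficient, hence also their gcd g, which is absurd.\<close>
    then have "\<forall>s\<in>S. int p dvd c s div g" using S is_idealD(2)[OF K] unfolding indep_def by metis
    then have "\<forall>s\<in>S. int p * g dvd c s" using gc by (metis mult.commute mult_dvd_mono dvd_refl)
    then have "int p * g dvd g" unfolding g_def by (intro Gcd_greatest) blast
    then have "int p dvd 1" using g by (metis dvd_mult_cancel_right mult_1)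
    then show False using assms by (auto simp: prime_nat_iff)
  qed
  have "indep {}" by (simp add: indep_def)
  then obtain S where S: "indep S" "\<And>S'. indep S' \<Longrightarrow> card S' \<le> card S"
    using ex_has_greatest_nat[of indep "{}" card "Suc d"] bound less_Suc_eq_le by metis
  have fin: "finite S" and SR: "S \<subseteq> R" using S(1) by (auto simp: indep_def)
  \<comment> \<open>A maximal independent set spans R/pR, so combinations with coefficients in 0..<p
    meet every class.\<close>
  define T where "T = (\<lambda>c. \<Sum>s\<in>S. of_int (c s) * s) ` (S \<rightarrow>\<^sub>E {0..<int p})"
  have "finite T" using fin by (simp add: T_def finite_PiE)
  moreover have "\<exists>t\<in>T. x - t \<in> K" if x: "x \<in> R" for x
  proof -
    have "\<exists>a (c :: complex \<Rightarrow> int). \<not> int p dvd a \<and> of_int a * x - (\<Sum>s\<in>S. of_int (c s) * s) \<in> K"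
    proof (cases "x \<in> S")
      case True
      have "(\<Sum>s\<in>S. of_int (if s = x then 1 else 0) * s) = x"
        using True fin by (simp add: if_distrib[of "\<lambda>u. of_int u * _"] sum.delta cong: if_cong)
      moreover have "\<not> int p dvd 1" using assms by (auto simp: prime_nat_iff)
      ultimately show ?thesis using is_idealD(2)[OF K]
        by (intro exI[of _ 1] exI[of _ "\<lambda>s. if s = x then 1 else 0"]) simp
    next
      case False
      then have "\<not> indep (insert x S)" using S(2)[of "insert x S"] fin by auto
      then obtain c :: "complex \<Rightarrow> int" where c: "(\<Sum>s\<in>insert x S. of_int (c s) * s) \<in> K"
          "\<exists>s\<in>insert x S. \<not> int p dvd c s"
        using fin SR x by (auto simp: indep_def)
      then have sum: "of_int (c x) * x + (\<Sum>s\<in>S. of_int (c s) * s) \<in> K" using fin False by simp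
      have "\<not> int p dvd c x"
      proof
        assume "int p dvd c x"
        then have "of_int (c x) * x \<in> K" using pK[OF x] by (auto elim!: dvdE)
        from ideal_diff[OF K sum this] have "(\<Sum>s\<in>S. of_int (c s) * s) \<in> K" by simp
        then have "\<forall>s\<in>S. int p dvd c s" using S(1) unfolding indep_def by metis
        then show False using c(2) \<open>int p dvd c x\<close> by blast
      qed
      then show ?thesis using sum
        by (intro exI[of _ "c x"] exI[of _ "\<lambda>s. - c s"]) (simp add: sum_negf)
    qed
    then obtain a and c :: "complex \<Rightarrow> int" where ac: "\<not> int p dvd a"
        "of_int a * x - (\<Sum>s\<in>S. of_int (c s) * s) \<in> K" by blast
    have "coprime (int p) a" using assms ac(1) by (simp add: prime_imp_coprime)
    \<comment> \<open>\<open>u\<close> inverts \<open>a\<close> modulo p, so the relation can be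
      solved for \<open>x\<close>.\<close>
    then obtain w u where wu: "w * int p + u * a = 1" using bezout_int[of "int p" a] by auto
    define c' where "c' = (\<lambda>s\<in>S. (u * c s) mod int p)"
    have "c' \<in> S \<rightarrow>\<^sub>E {0..<int p}" using assms prime_gt_0_nat by (auto simp: c'_def)
    then have T: "(\<Sum>s\<in>S. of_int (c' s) * s) \<in> T" by (auto simp: T_def)
    have sum_K: "(\<Sum>s\<in>S. of_int (u * c s - c' s) * s) \<in> K"
    proof -
      have "(\<Sum>s\<in>A. of_int (u * c s - c' s) * s) \<in> K" if "A \<subseteq> S" for A
        using finite_subset[OF that fin] that
      proof (induction A)
        case (insert s A)
        have "u * c s - c' s = int p * (u * c s div int p)"
          using insert.prems by (simp add: c'_def minus_mod_eq_mult_div)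
        then have "of_int (u * c s - c' s) * s \<in> K" using pK insert.prems SR by (metis insert_subset subsetD)
        then show ?case using insert is_idealD(3)[OF K] by simp
      qed (use is_idealD(2)[OF K] in simp)
      then show ?thesis by blast
    qed
    have "of_int (int p * w) * x + of_int u * (of_int a * x - (\<Sum>s\<in>S. of_int (c s) * s))
        + (\<Sum>s\<in>S. of_int (u * c s - c' s) * s) \<in> K"
      by (intro is_idealD(3)[OF K] is_idealD(4)[OF K] pK x ac(2) sum_K R_of_int)
    also have "of_int (int p * w) * x + of_int u * (of_int a * x - (\<Sum>s\<in>S. of_int (c s) * s))
        + (\<Sum>s\<in>S. of_int (u * c s - c' s) * s) = of_int (w * int p + u * a) * x - (\<Sum>s\<in>S. of_int (c' s) * s)"
      by (simp add: algebra_simps sum_subtractf sum_distrib_left)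
    finally show ?thesis using T wu by auto
  qed
  ultimately show ?thesis unfolding K_def by blast
qed

text \<open>Representatives are built like digits: modulo p * n they are t + p * u, with t taken
  modulo p and u modulo n.\<close>

lemma finite_residues:
  fixes n :: nat
  assumes "n > 0"
  shows "\<exists>T. finite T \<and> (\<forall>x\<in>R. \<exists>t\<in>T. x - t \<in> {of_nat n * r | r. r \<in> R})"
  using assms
proof (induction n rule: prime_divisors_induct)
  case (unit n)
  then have "n = 1" by simp
  then show ?case by (intro exI[of _ "{0}"]) auto
next
  case (factor p n)
  then have "n > 0" by simp
  then obtain U where U: "finite U" "\<forall>x\<in>R. \<exists>t\<in>U. x - t \<in> {of_nat n * r | r. r \<in> R}"
    using factor.IH by blast
  obtain T where T: "finite T" "\<forall>x\<in>R. \<exists>t\<in>T. x - t \<in> {of_nat p * r | r. r \<in> R}"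
    using finite_residues_prime factor.hyps by blast
  show ?case
  proof (intro exI[of _ "(\<lambda>(t,u). t + of_nat p * u) ` (T \<times> U)"] conjI ballI)
    show "finite ((\<lambda>(t,u). t + of_nat p * u) ` (T \<times> U))" using T U by simp
    fix x assume "x \<in> R"
    then obtain t r where t: "t \<in> T" "r \<in> R" "x - t = of_nat p * r" using T(2) by blast
    then obtain u s where u: "u \<in> U" "s \<in> R" "r - u = of_nat n * s" using U(2) by blast
    have "x - (t + of_nat p * u) = of_nat p * (r - u)" using t(3) by (simp add: algebra_simps)
    then have "x - (t + of_nat p * u) = of_nat (p * n) * s" using u(3) by simp
    then show "\<exists>t\<in>(\<lambda>(t,u). t + of_nat p * u) ` (T \<times> U). x - t \<in> {of_nat (p * n) * r | r. r \<in> R}"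
      using t(1) u(1,2) by force
  qed
qed simp

subsection \<open>Inverses of prime ideals\<close>

context
  fixes P :: "complex set"
  assumes P: "prime_ideal R P" "P \<noteq> {0}"
begin

lemma P_ideal: "is_ideal R P" and P_proper: "P \<noteq> R" and one_notin_P: "1 \<notin> P"
  and P_prime: "\<And>x y. x \<in> R \<Longrightarrow> y \<in> R \<Longrightarrow> x * y \<in> P \<Longrightarrow> x \<in> P \<or> y \<in> P"
  using P ideal_one_imp_R by (auto simp: prime_ideal_def)

lemma P_power: "x \<in> R \<Longrightarrow> x ^ i \<in> P \<Longrightarrow> x \<in> P"
  by (induction i) (use one_notin_P P_prime R_power in auto)

lemma P_power_in: "x \<in> P \<Longrightarrow> i > 0 \<Longrightarrow> x ^ i \<in> P"
  using ideal_mult_right[OF P_ideal, of x "x ^ (i - 1)"] R_power is_idealD(1)[OF P_ideal]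
  by (cases i) auto

text \<open>The principal ideal mR for m = \<open>int_gen P\<close>: it lies in \<open>P\<close> and
  has finite quotient, which makes it the modulus of every pigeonhole argument below.\<close>

definition mP :: "complex set" where
  "mP = {of_int (int_gen P) * r | r. r \<in> R}"

lemma mP_ideal: "is_ideal R mP"
  unfolding mP_def by (rule is_ideal_principal) simp

lemma mP_subset_P: "mP \<subseteq> P"
  using ideal_mult_right[OF P_ideal int_gen_in[OF P_ideal P(2)]] by (auto simp: mP_def)

lemma pigeonhole_mP:
  fixes f :: "nat \<Rightarrow> complex"
  assumes "\<And>i. f i \<in> R"
  obtains i j where "i < j" "f j - f i \<in> mP"
proof -
  obtain T where T: "finite T" "\<forall>x\<in>R. \<exists>t\<in>T. x - t \<in> mP"
    using finite_residues[of "nat (int_gen P)"] int_gen_pos[OF P_ideal P(2)] by (auto simp: mP_def)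
  then have "\<forall>i. \<exists>t\<in>T. f i - t \<in> mP" using assms by blast
  then obtain t where t: "\<And>i. t i \<in> T" "\<And>i. f i - t i \<in> mP" by metis
  have "\<not> inj t" using finite_subset[of "range t" T] T(1) t(1) range_inj_infinite by blast
  then obtain i j where "i \<noteq> j" "t i = t j" by (auto simp: inj_def)
  then obtain i j where ij: "i < j" "t i = t j" by (metis linorder_neq_iff)
  have "(f j - t j) - (f i - t i) \<in> mP" by (rule ideal_diff[OF mP_ideal t(2) t(2)])
  then show thesis using that ij by simp
qed

text \<open>Powers of \<open>z\<close> repeat modulo mR. Cancelling z ^ i, which lies outside the
  prime \<open>P\<close>, leaves a power of \<open>z\<close> congruent to 1 modulo
  \<open>P\<close>.\<close>

lemma P_maximal:
  assumes "z \<in> R" "z \<notin> P" obtains r where "r \<in> R" "1 - r * z \<in> P"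
proof -
  obtain i j where ij: "i < j" "z ^ j - z ^ i \<in> mP"
    using pigeonhole_mP[of "\<lambda>i. z ^ i"] R_power assms by blast
  have "z ^ i * (z ^ (j - i) - 1) \<in> P"
    using ij mP_subset_P by (auto simp: algebra_simps simp flip: power_add)
  moreover have "z ^ i \<notin> P" using P_power assms by blast
  moreover have "z ^ (j - i) - 1 \<in> R" by (intro R_diff R_power assms R_simps)
  ultimately have "z ^ (j - i) - 1 \<in> P" using P_prime R_power[OF assms(1)] by blast
  moreover have "z ^ (j - i) = z ^ (j - i - 1) * z"
    using ij(1) by (metis Suc_pred' power_Suc2 zero_less_diff)
  ultimately have "1 - z ^ (j - i - 1) * z \<in> P"
    using ideal_uminus[OF P_ideal, of "z ^ (j - i) - 1"] by simp
  then show thesis using that R_power assms by blast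
qed

lemma P_finite_mod_mP:
  obtains X where "finite X" "X \<subseteq> P" "\<And>y. y \<in> P \<Longrightarrow> \<exists>x\<in>X. y - x \<in> mP"
proof -
  obtain T where T: "finite T" "\<forall>x\<in>R. \<exists>t\<in>T. x - t \<in> mP"
    using finite_residues[of "nat (int_gen P)"] int_gen_pos[OF P_ideal P(2)] by (auto simp: mP_def)
  define T' where "T' = {t \<in> T. \<exists>x\<in>P. x - t \<in> mP}"
  have "\<forall>t\<in>T'. \<exists>x. x \<in> P \<and> x - t \<in> mP" by (auto simp: T'_def)
  then obtain f where f: "\<And>t. t \<in> T' \<Longrightarrow> f t \<in> P \<and> f t - t \<in> mP" by metis
  show thesis
  proof (rule that)
    show "finite (f ` T')" using T(1) by (simp add: T'_def)
    show "f ` T' \<subseteq> P" using f by blast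
    fix y assume y: "y \<in> P"
    then obtain t where t: "t \<in> T" "y - t \<in> mP" using T(2) is_idealD(1)[OF P_ideal] by blast
    then have "t \<in> T'" using y by (auto simp: T'_def)
    moreover have "y - f t \<in> mP" using ideal_diff[OF mP_ideal t(2), of "f t - t"] f[OF \<open>t \<in> T'\<close>] by simp
    ultimately show "\<exists>x\<in>f ` T'. y - x \<in> mP" by blast
  qed
qed

text \<open>A repetition of powers puts x ^ i * (x ^ (j - i) - 1) into mR, and the second factor is
  outside \<open>P\<close> because \<open>x\<close> is inside. The product of these factors over
  \<open>X\<close> is \<open>w\<close>.\<close>

lemma P_nilpotent_up_to_unit:
  assumes "finite X" "X \<subseteq> P"
  shows "\<exists>w\<in>R. w \<notin> P \<and> (\<forall>x\<in>X. \<exists>i. x ^ i * w \<in> mP)"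
  using assms
proof (induction X)
  case empty show ?case using one_notin_P R_simps by blast
next
  case (insert x X)
  then obtain w where w: "w \<in> R" "w \<notin> P" "\<forall>x\<in>X. \<exists>i. x ^ i * w \<in> mP" by auto
  have x: "x \<in> P" "x \<in> R" using insert.prems is_idealD(1)[OF P_ideal] by auto
  obtain i j where ij: "i < j" "x ^ j - x ^ i \<in> mP"
    using pigeonhole_mP[of "\<lambda>i. x ^ i"] R_power x by blast
  define v where "v = x ^ (j - i) - 1"
  have v: "v \<in> R" unfolding v_def using R_diff R_power x by simp
  have "v \<notin> P" using P_power_in[OF x(1), of "j - i"] ij(1) one_notin_P ideal_diff[OF P_ideal, of "x ^ (j - i)" v]
    by (auto simp: v_def)
  have "x ^ i * v \<in> mP" using ij by (simp add: v_def algebra_simps flip: power_add)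
  then have "x ^ i * (v * w) \<in> mP"
    using ideal_mult_right[OF mP_ideal _ w(1), of "x ^ i * v"] by (simp only: mult.assoc)
  moreover have "x' ^ k * (v * w) \<in> mP" if "x' ^ k * w \<in> mP" for x' k
    using is_idealD(4)[OF mP_ideal v that] by (simp add: mult.left_commute)
  moreover have "v * w \<in> R" "v * w \<notin> P" using P_prime w v \<open>v \<notin> P\<close> R_mult by blast+
  ultimately show ?case using w(3) by blast
qed

text \<open>Starting from \<open>w\<close>, nonzero modulo mR, multiply for each representative x of
  \<open>P\<close> by the highest power of x that keeps the product nonzero. The result is killed by
  x and by all earlier representatives.\<close>

lemma exists_annihilator: "\<exists>u\<in>R. u \<notin> mP \<and> (\<forall>y\<in>P. u * y \<in> mP)"
proof -
  obtain X where X: "finite X" "X \<subseteq> P" "\<And>y. y \<in> P \<Longrightarrow> \<exists>x\<in>X. y - x \<in> mP" using P_finite_mod_mP by blast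
  obtain w where w: "w \<in> R" "w \<notin> P" "\<forall>x\<in>X. \<exists>i. x ^ i * w \<in> mP"
    using P_nilpotent_up_to_unit X by blast
  have "\<exists>r\<in>R. r * w \<notin> mP \<and> (\<forall>x\<in>Y. r * w * x \<in> mP)" if "Y \<subseteq> X" for Y
    using finite_subset[OF that X(1)] that
  proof (induction Y)
    case empty
    have "1 * w \<notin> mP" using w(2) mP_subset_P by auto
    then show ?case using R_simps by blast
  next
    case (insert x Y)
    then obtain r where r: "r \<in> R" "r * w \<notin> mP" "\<forall>x\<in>Y. r * w * x \<in> mP" by auto
    have x: "x \<in> R" using insert.prems X(2) is_idealD(1)[OF P_ideal] by auto
    let ?Q = "\<lambda>i. x ^ i * (r * w) \<in> mP"
    obtain i where "x ^ i * w \<in> mP" using w(3) insert.prems by blast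
    then have "?Q i" using is_idealD(4)[OF mP_ideal r(1)] by (simp add: mult.left_commute)
    then have Q: "?Q (Least ?Q)" by (rule LeastI)
    \<comment> \<open>The least exponent is not 0, since r * w itself is outside \<open>mP\<close>;
      its predecessor gives the new multiplier.\<close>
    then obtain k where k: "Least ?Q = Suc k" using r(2) by (cases "Least ?Q") auto
    then have "\<not> ?Q k" using not_less_Least[of k ?Q] by simp
    moreover have "x ^ k * (r * w) * x \<in> mP" using Q k by (simp add: mult_ac)
    moreover have "x ^ k * (r * w) * y \<in> mP" if "y \<in> Y" for y
    proof -
      have "x ^ k * (r * w * y) \<in> mP" using is_idealD(4)[OF mP_ideal R_power[OF x]] r(3) that by blast
      then show ?thesis by (simp only: mult.assoc)
    qed
    ultimately show ?case using R_mult[OF R_power[OF x, of k] r(1)]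
      by (intro bexI[of _ "x ^ k * r"]) (auto simp: mult.assoc)
  qed
  from this[OF subset_refl] obtain r where r: "r \<in> R" "r * w \<notin> mP" "\<forall>x\<in>X. r * w * x \<in> mP" by blast
  have "r * w * y \<in> mP" if "y \<in> P" for y
  proof -
    obtain x where x: "x \<in> X" "y - x \<in> mP" using X(3) \<open>y \<in> P\<close> by blast
    have "r * w * x + r * w * (y - x) \<in> mP"
      by (intro is_idealD(3)[OF mP_ideal] is_idealD(4)[OF mP_ideal R_mult[OF r(1) w(1)]] x(2)
          bspec[OF r(3) x(1)])
    then show ?thesis by (simp add: algebra_simps)
  qed
  then show ?thesis using r w R_mult by blast
qed

text \<open>Invertibility of \<open>P\<close> expressed without fractional ideals: P + xP lies in
  \<open>R\<close> and contains 1.\<close>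

lemma prime_ideal_inverse:
  obtains x y0 y1 where "\<And>y. y \<in> P \<Longrightarrow> x * y \<in> R" "y0 \<in> P" "y1 \<in> P" "1 = y0 + x * y1"
proof -
  obtain u where u: "u \<in> R" "u \<notin> mP" "\<And>y. y \<in> P \<Longrightarrow> u * y \<in> mP" using exists_annihilator by blast
  define m where "m = int_gen P"
  have m: "m > 0" "of_int m \<in> P" using int_gen_pos int_gen_in P_ideal P(2) by (auto simp: m_def)
  define x where "x = u / of_int m"
  have mR: "r \<in> R" if "of_int m * r \<in> mP" for r
    using that m(1) by (auto simp: mP_def m_def)
  have xP: "x * y \<in> R" if "y \<in> P" for y
    using mR[of "x * y"] u(3)[OF that] m(1) by (simp add: x_def)
  have xL: "x \<in> L" using L_divide[OF R_subset_L[OF u(1)] L_of_int] by (simp add: x_def)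
  have "x \<notin> R"
  proof
    assume "x \<in> R"
    then have "of_int m * x \<in> mP" by (auto simp: mP_def m_def)
    then show False using u(2) m(1) by (simp add: x_def)
  qed
  have "\<exists>y\<in>P. x * y \<notin> P"
  proof (rule ccontr)
    assume "\<not> (\<exists>y\<in>P. x * y \<notin> P)"
    then have "x ^ k * of_int m \<in> P" for k using m(2) by (induction k) (auto simp: mult.assoc)
    then have "x ^ k * of_int m \<in> R" for k using is_idealD(1)[OF P_ideal] by blast
    then obtain i j where ij: "i < j" "x ^ j * of_int m - x ^ i * of_int m \<in> mP"
      using pigeonhole_mP[of "\<lambda>k. x ^ k * of_int m"] by blast
    then have "x ^ j - x ^ i \<in> R" by (intro mR) (simp add: algebra_simps)
    then show False using R_integrally_closed[OF xL ij(1)] \<open>x \<notin> R\<close> by blast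
  qed
  then obtain y where y: "y \<in> P" "x * y \<notin> P" by blast
  obtain r where r: "r \<in> R" "1 - r * (x * y) \<in> P" using P_maximal[OF xP[OF y(1)] y(2)] by blast
  show thesis
  proof (rule that)
    show "1 = (1 - r * (x * y)) + x * (r * y)" by simp
    show "r * y \<in> P" using is_idealD(4)[OF P_ideal r(1) y(1)] .
  qed (use xP r in auto)
qed

end

end

context localized_integers
begin

subsection \<open>Powers of prime ideals\<close>

text \<open>Ideal products are intersections of ideals. Placing one inside this ideal reduces a
  claim about all its elements to single products. Here \<open>w\<close> may be a fraction, such as
  the \<open>x\<close> of \<open>prime_ideal_inverse\<close>.\<close>

lemma is_ideal_transporter:
  assumes "is_ideal R J" shows "is_ideal R {a \<in> R. w * a \<in> J}"
  unfolding is_ideal_def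
proof (intro conjI ballI)
  show "0 \<in> {a \<in> R. w * a \<in> J}" using is_idealD(2)[OF assms] by simp
  fix a assume a: "a \<in> {a \<in> R. w * a \<in> J}"
  {
    fix b assume b: "b \<in> {a \<in> R. w * a \<in> J}"
    then show "a + b \<in> {a \<in> R. w * a \<in> J}"
      using a R_add is_idealD(3)[OF assms, of "w * a" "w * b"] by (simp add: distrib_left)
  next
    fix r assume r: "r \<in> R"
    then show "r * a \<in> {a \<in> R. w * a \<in> J}"
      using a R_mult is_idealD(4)[OF assms r, of "w * a"] by (simp add: mult.left_commute)
  }
qed auto

lemma ideal_mult_R_left:
  assumes "is_ideal R I" shows "ideal_mult R R I = I"
proof
  show "ideal_mult R R I \<subseteq> I" by (rule ideal_mult_subset_right[OF is_ideal_R assms])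
  show "I \<subseteq> ideal_mult R R I" using mult_in_ideal_mult[of 1 R _ I R] by auto
qed

lemma is_ideal_pow: "is_ideal R I \<Longrightarrow> is_ideal R (ideal_pow R I k)"
  by (induction k) (auto intro: is_ideal_R is_ideal_mult)

lemma ideal_pow_1: "is_ideal R I \<Longrightarrow> ideal_pow R I (Suc 0) = I"
  by (simp add: ideal_mult_R_left)

lemma ideal_pow_2: "is_ideal R I \<Longrightarrow> ideal_pow R I 2 = ideal_mult R I I"
  by (simp add: numeral_2_eq_2 ideal_mult_R_left)

lemma ideal_pow_antimono:
  assumes "is_ideal R I" "k \<le> l" shows "ideal_pow R I l \<subseteq> ideal_pow R I k"
  using assms(2) by (rule lift_Suc_antimono_le[rotated])
    (simp add: ideal_mult_subset_left is_ideal_pow assms(1))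

lemma power_in_ideal_pow: "x \<in> I \<Longrightarrow> x ^ k \<in> ideal_pow R I k"
  by (induction k) (auto simp: power_Suc2 intro: mult_in_ideal_mult simp del: power_Suc)

lemma mult_in_ideal_pow_add:
  assumes I: "is_ideal R I" and s: "s \<in> ideal_pow R I i" and t: "t \<in> ideal_pow R I j"
  shows "s * t \<in> ideal_pow R I (i + j)"
  using t
proof (induction j arbitrary: t)
  case 0
  then show ?case using ideal_mult_right[OF is_ideal_pow[OF I] s] by simp
next
  case (Suc j)
  have "ideal_mult R (ideal_pow R I j) I \<subseteq> {a \<in> R. s * a \<in> ideal_pow R I (i + Suc j)}"
  proof (rule ideal_mult_subset[OF is_ideal_transporter[OF is_ideal_pow[OF I]]])
    fix x y assume xy: "x \<in> ideal_pow R I j" "y \<in> I"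
    have "x \<in> R" "y \<in> R" using xy is_idealD(1)[OF is_ideal_pow[OF I]] is_idealD(1)[OF I] by blast+
    moreover have "(s * x) * y \<in> ideal_pow R I (i + Suc j)"
      using mult_in_ideal_mult[OF Suc.IH[OF xy(1)] xy(2)] by simp
    ultimately show "x * y \<in> {a \<in> R. s * a \<in> ideal_pow R I (i + Suc j)}"
      using R_mult by (simp add: mult.assoc)
  qed
  then show ?case using Suc.prems by auto
qed

lemma Z_loc_subset_R: "Z_loc \<eta> \<subseteq> R"
  using R_divide_eta[OF R_of_int] by (auto simp: Z_loc_def)

context
  fixes P :: "complex set"
  assumes P: "prime_ideal R P" "P \<noteq> {0}"
begin

lemma prime_int_gen: "prime (int_gen P)"
proof -
  note P_ideal = P_ideal[OF P]
  note iff = of_int_in_ideal_iff[OF P_ideal P(2)]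
  have "prime_elem (int_gen P)"
  proof (rule prime_elemI)
    show "int_gen P \<noteq> 0" using int_gen_pos[OF P_ideal P(2)] by simp
    show "\<not> is_unit (int_gen P)" unfolding iff[symmetric] using one_notin_P[OF P] by simp
    fix a b assume "int_gen P dvd a * b"
    then have "of_int a * of_int b \<in> P" using iff[of "a * b"] by simp
    then show "int_gen P dvd a \<or> int_gen P dvd b"
      using P_prime[OF P R_of_int R_of_int] iff by blast
  qed
  moreover have "normalize (int_gen P) = int_gen P" using int_gen_pos[OF P_ideal P(2)] by simp
  ultimately show ?thesis by (rule primeI)
qed

text \<open>Multiplication by the inverse element x sends PP into P. If P were inside PP, then x *
  y1 and hence 1 = y0 + x * y1 would lie in P.\<close>

lemma prime_ideal_not_idempotent: "\<not> P \<subseteq> ideal_mult R P P"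
proof
  assume sub: "P \<subseteq> ideal_mult R P P"
  obtain x y0 y1 where x: "\<And>y. y \<in> P \<Longrightarrow> x * y \<in> R" "y0 \<in> P" "y1 \<in> P" "1 = y0 + x * y1"
    using prime_ideal_inverse[OF P] by blast
  have "ideal_mult R P P \<subseteq> {a \<in> R. x * a \<in> P}"
  proof (rule ideal_mult_subset[OF is_ideal_transporter[OF P_ideal[OF P]]])
    fix s t assume st: "s \<in> P" "t \<in> P"
    have "(x * s) * t \<in> P" using is_idealD(4)[OF P_ideal[OF P] x(1)[OF st(1)] st(2)] .
    then show "s * t \<in> {a \<in> R. x * a \<in> P}"
      using st R_mult is_idealD(1)[OF P_ideal[OF P]] by (auto simp: mult.assoc)
  qed
  then have "x * y1 \<in> P" using sub x(3) by blast
  then have "1 \<in> P" using is_idealD(3)[OF P_ideal[OF P] x(2)] x(4) by metis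
  then show False using one_notin_P[OF P] by blast
qed

text \<open>P/PP is one-dimensional over R/P. As c = c * y0 + (x * c) * y1 is outside PP, x * c is
  outside P; with r its inverse modulo P, \<open>y\<close> is congruent to (r * (x * y)) *
  c.\<close>

lemma generates_mod_square:
  assumes c: "c \<in> P" "c \<notin> ideal_mult R P P" and y: "y \<in> P"
  obtains r where "r \<in> R" "y - r * c \<in> ideal_mult R P P"
proof -
  note I = P_ideal[OF P]
  obtain x y0 y1 where x: "\<And>y. y \<in> P \<Longrightarrow> x * y \<in> R" "y0 \<in> P" "y1 \<in> P" "1 = y0 + x * y1"
    using prime_ideal_inverse[OF P] by blast
  have "x * c \<notin> P"
  proof
    assume "x * c \<in> P"
    then have "c * y0 + (x * c) * y1 \<in> ideal_mult R P P"
      using c(1) x by (intro is_idealD(3)[OF is_ideal_mult[OF I I]] mult_in_ideal_mult)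
    moreover have "c * y0 + (x * c) * y1 = c * (y0 + x * y1)" by (simp add: algebra_simps)
    ultimately show False using c(2) x(4) by simp
  qed
  then obtain r where r: "r \<in> R" "1 - r * (x * c) \<in> P" using P_maximal[OF P x(1)[OF c(1)]] by blast
  have "(1 - r * (x * c)) * y \<in> ideal_mult R P P" using r(2) y by (rule mult_in_ideal_mult)
  also have "(1 - r * (x * c)) * y = y - (r * (x * y)) * c" by (simp add: algebra_simps)
  finally show thesis using that R_mult[OF r(1) x(1)[OF y]] by blast
qed

text \<open>The cofactor is $c P^{-2}$.\<close>

lemma square_dvd_principal:
  assumes c: "c \<in> ideal_mult R P P"
  shows "ideal_dvd R (ideal_mult R P P) (ideal_gen R {c})"
proof -
  note I = P_ideal[OF P] and I2 = is_ideal_mult[OF P_ideal[OF P] P_ideal[OF P]]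
  obtain x y0 y1 where x: "\<And>y. y \<in> P \<Longrightarrow> x * y \<in> R" "y0 \<in> P" "y1 \<in> P" "1 = y0 + x * y1"
    using prime_ideal_inverse[OF P] by blast
  have PR: "s \<in> R" if "s \<in> P" for s using is_idealD(1)[OF I] that by blast
  have cR: "c \<in> R" using is_idealD(1)[OF I2] c by blast
  have cP: "c \<in> P" using ideal_mult_subset_left[OF I I] c by blast
  define J where "J = {c * r | r. r \<in> R}"
  have J: "is_ideal R J" and gen: "ideal_gen R {c} = J"
    using is_ideal_principal[OF cR] ideal_gen_singleton[OF cR] by (simp_all add: J_def)
  \<comment> \<open>The cofactor presented inside \<open>R\<close>: the elements that multiply PP
    into cR.\<close>
  define K where "K = {k \<in> R. \<forall>s\<in>P. \<forall>t\<in>P. (s * t) * k \<in> J}"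
  have K: "is_ideal R K"
  proof -
    have "0 \<in> K" using is_idealD(2)[OF J] by (simp add: K_def)
    moreover have "k + l \<in> K" if "k \<in> K" "l \<in> K" for k l
      using that R_add is_idealD(3)[OF J] by (simp add: K_def distrib_left)
    moreover have "r * k \<in> K" if "r \<in> R" "k \<in> K" for r k
    proof -
      have "s * t * (r * k) \<in> J" if "s \<in> P" "t \<in> P" for s t
      proof -
        have "r * (s * t * k) \<in> J" using \<open>k \<in> K\<close> that by (intro is_idealD(4)[OF J \<open>r \<in> R\<close>]) (simp add: K_def)
        then show ?thesis by (simp only: mult_ac)
      qed
      then show ?thesis using that R_mult by (simp add: K_def)
    qed
    ultimately show ?thesis unfolding is_ideal_def by (auto simp: K_def)
  qed
  have "ideal_mult R (ideal_mult R P P) K \<subseteq> J"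
  proof (rule ideal_mult_subset[OF J])
    fix a k assume a: "a \<in> ideal_mult R P P" and k: "k \<in> K"
    have "ideal_mult R P P \<subseteq> {a \<in> R. k * a \<in> J}"
      by (rule ideal_mult_subset[OF is_ideal_transporter[OF J]])
         (use k PR R_mult in \<open>auto simp: K_def mult.commute\<close>)
    then show "a * k \<in> J" using a by (auto simp: mult.commute)
  qed
  moreover have "J \<subseteq> ideal_mult R (ideal_mult R P P) K"
  proof -
    have "ideal_mult R P P \<subseteq> {a \<in> R. (x * x) * a \<in> R}"
    proof (rule ideal_mult_subset[OF is_ideal_transporter[OF is_ideal_R]])
      fix s t assume st: "s \<in> P" "t \<in> P"
      have "(x * s) * (x * t) \<in> R" using R_mult x(1) st by blast
      then show "s * t \<in> {a \<in> R. x * x * a \<in> R}" using R_mult[OF PR PR] st by (simp add: mult_ac)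
    qed
    then have xxc: "(x * x) * c \<in> R" using c by blast
    have inJ: "c * r \<in> J" if "r \<in> R" for r using that by (auto simp: J_def)
    have 0: "c \<in> K"
      using cR inJ[OF R_mult[OF PR PR]] by (simp add: K_def mult.commute)
    have "s * t * (x * c) \<in> J" if "s \<in> P" "t \<in> P" for s t
      using inJ[OF R_mult[OF x(1) PR], of s t] that by (simp add: mult_ac)
    then have 1: "x * c \<in> K" using x(1)[OF cP] by (simp add: K_def)
    have "s * t * (x * x * c) \<in> J" if "s \<in> P" "t \<in> P" for s t
      using inJ[OF R_mult[OF x(1) x(1)], of s t] that by (simp add: mult_ac)
    then have 2: "x * x * c \<in> K" using xxc by (simp add: K_def)
    note [intro] = is_idealD(3)[OF is_ideal_mult[OF I2 K]] mult_in_ideal_mult x(2,3) 0 1 2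
    \<comment> \<open>The expansion of (y0 + x * y1) ^ 2 * c = c: each term is an element of PP
      times one of c, x * c, x * x * c, all in \<open>K\<close>.\<close>
    have "(y0 * y0) * c + (y0 * y1) * (x * c) + (y0 * y1) * (x * c) + (y1 * y1) * (x * x * c)
        \<in> ideal_mult R (ideal_mult R P P) K" by blast
    moreover have "(y0 * y0) * c + (y0 * y1) * (x * c) + (y0 * y1) * (x * c) + (y1 * y1) * (x * x * c)
        = (y0 + x * y1) * (y0 + x * y1) * c" by (simp add: algebra_simps)
    ultimately have "c \<in> ideal_mult R (ideal_mult R P P) K" using x(4) by simp
    then show ?thesis using ideal_mult_right[OF is_ideal_mult[OF I2 K]] by (auto simp: J_def)
  qed
  ultimately show ?thesis unfolding ideal_dvd_def gen using K by blast
qed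

text \<open>The prime in \<open>ramified\<close> is only known to generate P within
  \<open>Z_loc\<close>; \<open>int_gen P\<close> is a multiple of it by an element of
  \<open>R\<close>, so it follows that prime into PP. The converse is divisibility of principal
  ideals by PP.\<close>

lemma ramified_iff: "ramified L \<eta> P \<longleftrightarrow> of_int (int_gen P) \<in> ideal_mult R P P"
proof
  note I = P_ideal[OF P] and I2 = is_ideal_mult[OF P_ideal[OF P] P_ideal[OF P]]
  assume "ramified L \<eta> P"
  then obtain p :: nat and K where p: "P \<inter> Z_loc \<eta> = {of_nat p * z | z. z \<in> Z_loc \<eta>}"
      "is_ideal R K" "ideal_gen R {of_nat p} = ideal_mult R (ideal_mult R P P) K"
    unfolding ramified_def ideal_dvd_def ideal_pow_2[OF I] by blast
  have "of_nat p \<in> ideal_mult R P P"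
    using ideal_mult_subset_left[OF I2 p(2)] subset_ideal_gen[of "{of_nat p}" R] p(3) by auto
  moreover have "of_int (int_gen P) \<in> P \<inter> Z_loc \<eta>"
    using int_gen_in[OF I P(2)] of_int_Z_loc[OF I P(2)] by blast
  then obtain z where "z \<in> Z_loc \<eta>" "of_int (int_gen P) = of_nat p * z" unfolding p(1) by blast
  ultimately show "of_int (int_gen P) \<in> ideal_mult R P P"
    using ideal_mult_right[OF I2] Z_loc_subset_R by auto
next
  note I = P_ideal[OF P]
  assume c: "of_int (int_gen P) \<in> ideal_mult R P P"
  have p: "prime (nat (int_gen P))" using prime_int_gen prime_nat_iff_prime by blast
  have eq: "(of_nat (nat (int_gen P)) :: complex) = of_int (int_gen P)"
    using int_gen_pos[OF I P(2)] by simp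
  show "ramified L \<eta> P"
    unfolding ramified_def ideal_pow_2[OF I]
    using p ideal_Int_Z_loc[OF I P(2)] square_dvd_principal[OF c]
    by (intro exI[of _ "nat (int_gen P)"]) (simp only: eq)
qed

text \<open>A p-adic expansion with p = \<open>int_gen P\<close>: if p is outside PP, then P^k
  consists of integer multiples of p ^ k modulo P^(k+1), and each approximation is improved by one
  more digit.\<close>

lemma ideal_pow_cong_int:
  assumes deg: "\<And>x. x \<in> R \<Longrightarrow> \<exists>z::int. x - of_int z \<in> P"
    and unram: "e > 1 \<Longrightarrow> of_int (int_gen P) \<notin> ideal_mult R P P"
    and x: "x \<in> R"
  shows "\<exists>z::int. x - of_int z \<in> ideal_pow R P e"
proof (cases "e > 1")
  case False
  then have "e = 0 \<or> e = Suc 0" by auto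
  then show ?thesis using deg[OF x] ideal_pow_1[OF P_ideal[OF P]] x R_diff[OF x R_of_int] by auto
next
  case True
  note I = P_ideal[OF P]
  define p where "p = int_gen P"
  have p: "of_int p \<in> P" "of_int p \<notin> ideal_mult R P P"
    using int_gen_in[OF I P(2)] unram[OF True] by (auto simp: p_def)
  have PR: "s \<in> R" if "s \<in> P" for s using is_idealD(1)[OF I] that by blast
  have PkR: "s \<in> R" if "s \<in> ideal_pow R P k" for s k using is_idealD(1)[OF is_ideal_pow[OF I]] that by blast
  \<comment> \<open>The coefficient of p supplied by \<open>generates_mod_square\<close> is in
    \<open>R\<close>; changing it to an integer congruent modulo P costs only an element of
    PP.\<close>
  have lin: "\<exists>z::int. y - of_int z * of_int p \<in> ideal_pow R P 2" if y: "y \<in> P" for y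
  proof -
    obtain r where r: "r \<in> R" "y - r * of_int p \<in> ideal_mult R P P"
      using generates_mod_square[OF p y] by blast
    obtain z where z: "r - of_int z \<in> P" using deg[OF r(1)] by blast
    have "(y - r * of_int p) + (r - of_int z) * of_int p \<in> ideal_mult R P P"
      using r(2) mult_in_ideal_mult[OF z p(1)] by (intro is_idealD(3)[OF is_ideal_mult[OF I I]])
    then show ?thesis unfolding ideal_pow_2[OF I] by (auto simp: algebra_simps)
  qed
  have step: "\<exists>z::int. y - of_int z * of_int p ^ k \<in> ideal_pow R P (Suc k)" if "y \<in> ideal_pow R P k" for y k
    using that
  proof (induction k arbitrary: y)
    case 0
    then show ?case using deg ideal_pow_1[OF I] by simp
  next
    case (Suc k)
    define J where "J = ideal_pow R P (Suc (Suc k))"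
    have J: "is_ideal R J" unfolding J_def by (rule is_ideal_pow[OF I])
    have pk: "of_int p ^ j \<in> ideal_pow R P j" for j by (rule power_in_ideal_pow[OF p(1)])
    \<comment> \<open>Integer multiples of p ^ (k+1) plus P^(k+2) form an ideal: a multiplier r may
      be replaced by an integer congruent modulo P, with error in P^(k+2). Hence only products s * t
      need checking.\<close>
    define M where "M = {y \<in> R. \<exists>z::int. y - of_int z * of_int p ^ Suc k \<in> J}"
    have M: "is_ideal R M"
    proof -
      have "0 \<in> M" using is_idealD(2)[OF J] by (auto simp: M_def intro: exI[of _ "0::int"])
      moreover have "a + b \<in> M" if ab: "a \<in> M" "b \<in> M" for a b
      proof -
        obtain z w :: int where zw: "a - of_int z * of_int p ^ Suc k \<in> J" "b - of_int w * of_int p ^ Suc k \<in> J"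
          using ab by (auto simp: M_def)
        have "a + b - of_int (z + w) * of_int p ^ Suc k \<in> J"
          using is_idealD(3)[OF J zw] by (simp add: algebra_simps)
        then show ?thesis using ab R_add unfolding M_def by blast
      qed
      moreover have "r * a \<in> M" if ra: "r \<in> R" "a \<in> M" for r a
      proof -
        obtain z :: int where z: "a - of_int z * of_int p ^ Suc k \<in> J" using ra by (auto simp: M_def)
        obtain w :: int where w: "r - of_int w \<in> P" using deg[OF ra(1)] by blast
        have "of_int z * (of_int p ^ Suc k * (r - of_int w)) \<in> J"
          unfolding J_def ideal_pow.simps(2)[of R P "Suc k"]
          by (intro is_idealD(4)[OF is_ideal_mult[OF is_ideal_pow[OF I] I] R_of_int] mult_in_ideal_mult pk w)
        then have "r * (a - of_int z * of_int p ^ Suc k) + of_int z * (of_int p ^ Suc k * (r - of_int w)) \<in> J"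
          by (intro is_idealD(3)[OF J] is_idealD(4)[OF J ra(1) z])
        then have "r * a - of_int (w * z) * of_int p ^ Suc k \<in> J" by (simp add: algebra_simps)
        then show ?thesis using ra R_mult unfolding M_def by blast
      qed
      ultimately show ?thesis unfolding is_ideal_def by (auto simp: M_def)
    qed
    have "ideal_mult R (ideal_pow R P k) P \<subseteq> M"
    proof (rule ideal_mult_subset[OF M])
      fix s t assume s: "s \<in> ideal_pow R P k" and t: "t \<in> P"
      obtain z :: int where z: "s - of_int z * of_int p ^ k \<in> ideal_pow R P (Suc k)" using Suc.IH[OF s] by blast
      obtain w :: int where w: "t - of_int w * of_int p \<in> ideal_pow R P 2" using lin[OF t] by blast
      have "(s - of_int z * of_int p ^ k) * t \<in> J"
        unfolding J_def ideal_pow.simps(2)[of R P "Suc k"] by (rule mult_in_ideal_mult[OF z t])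
      moreover have "of_int z * (of_int p ^ k * (t - of_int w * of_int p)) \<in> J"
        using is_idealD(4)[OF J R_of_int] mult_in_ideal_pow_add[OF I pk w, of k] by (simp add: J_def)
      ultimately have "(s - of_int z * of_int p ^ k) * t + of_int z * (of_int p ^ k * (t - of_int w * of_int p)) \<in> J"
        by (rule is_idealD(3)[OF J])
      then have "s * t - of_int (z * w) * of_int p ^ Suc k \<in> J" by (simp add: algebra_simps)
      then show "s * t \<in> M" using R_mult[OF PkR[OF s] PR[OF t]] unfolding M_def by blast
    qed
    then show ?case using Suc.prems by (auto simp: M_def J_def)
  qed
  show ?thesis
  proof (induction e)
    case 0
    then show ?case using R_diff[OF x R_of_int] by simp
  next
    case (Suc e)
    then obtain z :: int where z: "x - of_int z \<in> ideal_pow R P e" by blast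
    obtain w :: int where "x - of_int z - of_int w * of_int p ^ e \<in> ideal_pow R P (Suc e)"
      using step[OF z] by blast
    then have "x - of_int (z + w * p ^ e) \<in> ideal_pow R P (Suc e)" by (simp add: algebra_simps)
    then show ?case by blast
  qed
qed

end

subsection \<open>Degree one ideals and their factorizations\<close>

text \<open>Chinese remaindering straight into the product: m * (x - b) and (x - a) * n already lie
  in AB, and u * m + v * n = 1 combines them to x minus an integer.\<close>

lemma ideal_mult_cong_int:
  assumes A: "is_ideal R A" "\<And>x. x \<in> R \<Longrightarrow> \<exists>z::int. x - of_int z \<in> A" "of_int m \<in> A"
    and B: "is_ideal R B" "\<And>x. x \<in> R \<Longrightarrow> \<exists>z::int. x - of_int z \<in> B" "of_int n \<in> B"
    and mn: "coprime m n" and x: "x \<in> R"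
  shows "\<exists>z::int. x - of_int z \<in> ideal_mult R A B"
proof -
  obtain a b :: int where a: "x - of_int a \<in> A" and b: "x - of_int b \<in> B" using A(2) B(2) x by blast
  obtain u v where uv: "u * m + v * n = 1" using bezout_int[of m n] mn by auto
  note AB = is_ideal_mult[OF A(1) B(1)]
  have "of_int u * (of_int m * (x - of_int b)) + of_int v * ((x - of_int a) * of_int n) \<in> ideal_mult R A B"
    by (intro is_idealD(3)[OF AB] is_idealD(4)[OF AB R_of_int] mult_in_ideal_mult A(3) B(3) a b)
  also have "of_int u * (of_int m * (x - of_int b)) + of_int v * ((x - of_int a) * of_int n)
      = of_int (u * m + v * n) * x - of_int (u * m * b + v * n * a)" by (simp add: algebra_simps)
  finally show ?thesis unfolding uv of_int_1 mult_1 by blast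
qed

lemma is_ideal_factor_prod:
  "(\<And>i. i < r \<Longrightarrow> is_ideal R (P i)) \<Longrightarrow> is_ideal R (ideal_factor_prod R P e r)"
  by (induction r) (auto intro: is_ideal_R is_ideal_mult is_ideal_pow)

lemma ideal_factor_prod_subset:
  "(\<And>i. i < r \<Longrightarrow> is_ideal R (P i)) \<Longrightarrow> i < r \<Longrightarrow> ideal_factor_prod R P e r \<subseteq> ideal_pow R (P i) (e i)"
proof (induction r)
  case (Suc r)
  have I: "is_ideal R (ideal_factor_prod R P e r)" "is_ideal R (ideal_pow R (P r) (e r))"
    using Suc.prems by (auto intro: is_ideal_factor_prod is_ideal_pow)
  show ?case
  proof (cases "i = r")
    case True
    then show ?thesis using ideal_mult_subset_right[OF I] by simp
  next
    case False
    then show ?thesis using ideal_mult_subset_left[OF I] Suc by fastforce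
  qed
qed simp

text \<open>The integer in the partial product is carried through the induction because the
  remainder step needs it to be coprime to the next prime power.\<close>

lemma ideal_factor_prod_cong_int:
  assumes P: "\<And>i. i < r \<Longrightarrow> is_ideal R (P i)" "\<And>i. i < r \<Longrightarrow> of_int (p i) \<in> P i"
    and deg: "\<And>i x. i < r \<Longrightarrow> x \<in> R \<Longrightarrow> \<exists>z::int. x - of_int z \<in> ideal_pow R (P i) (e i)"
    and cop: "\<And>i j. j < i \<Longrightarrow> i < r \<Longrightarrow> coprime (p j) (p i)"
  shows "of_int (\<Prod>i<r. p i ^ e i) \<in> ideal_factor_prod R P e r \<and>
    (\<forall>x\<in>R. \<exists>z::int. x - of_int z \<in> ideal_factor_prod R P e r)"
  using assms
proof (induction r)
  case 0
  show ?case using R_diff[OF _ R_of_int] by simp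
next
  case (Suc r)
  let ?A = "ideal_factor_prod R P e r" and ?B = "ideal_pow R (P r) (e r)"
  have I: "is_ideal R ?A" "is_ideal R ?B"
    using Suc.prems by (auto intro: is_ideal_factor_prod is_ideal_pow)
  have IH: "of_int (\<Prod>i<r. p i ^ e i) \<in> ?A" "\<forall>x\<in>R. \<exists>z::int. x - of_int z \<in> ?A"
    using Suc.IH Suc.prems by auto
  have B: "of_int (p r ^ e r) \<in> ?B" using power_in_ideal_pow Suc.prems(2) by simp
  have cop: "coprime (\<Prod>i<r. p i ^ e i) (p r ^ e r)"
    by (intro prod_coprime_left) (use Suc.prems(4) in simp)
  have "\<exists>z::int. x - of_int z \<in> ideal_mult R ?A ?B" if "x \<in> R" for x
    by (rule ideal_mult_cong_int[OF I(1) _ IH(1) I(2) _ B cop that])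
       (use IH(2) Suc.prems(3) in auto)
  moreover have "of_int (\<Prod>i<Suc r. p i ^ e i) \<in> ideal_mult R ?A ?B"
    using mult_in_ideal_mult[OF IH(1) B] by simp
  ultimately show ?case by simp
qed

lemma degree_one_factorization_iff:
  assumes a: "is_ideal R a" "a \<noteq> {0}" "a \<noteq> R"
    and P: "\<And>i. i < r \<Longrightarrow> prime_ideal R (P i)" "\<And>i. i < r \<Longrightarrow> P i \<noteq> {0}"
    and e: "\<And>i. i < r \<Longrightarrow> e i \<ge> 1"
    and distinct: "\<And>i j. i < r \<Longrightarrow> j < r \<Longrightarrow> i \<noteq> j \<Longrightarrow> P i \<noteq> P j"
    and fact: "a = ideal_factor_prod R P e r"
  shows "degree_one L \<eta> a \<longleftrightarrow>
    (\<forall>i<r. degree_one L \<eta> (P i) \<and> (ramified L \<eta> (P i) \<longrightarrow> e i = 1)) \<and>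
    (\<forall>i<r. \<forall>j<r. i < j \<longrightarrow> gcd (abs_norm L \<eta> (P i)) (abs_norm L \<eta> (P j)) = 1)"
proof -
  have I: "is_ideal R (P i)" "P i \<noteq> R" if "i < r" for i
    using P_ideal[OF P(1,2)[OF that]] P_proper[OF P(1,2)[OF that]] .
  have deg: "degree_one L \<eta> (P i) \<longleftrightarrow> (\<forall>x\<in>R. \<exists>z::int. x - of_int z \<in> P i)" if "i < r" for i
    by (rule degree_one_iff[OF I(1)[OF that] P(2)[OF that] I(2)[OF that]])
  have norm: "int (abs_norm L \<eta> (P i)) = int_gen (P i)" if "i < r" "degree_one L \<eta> (P i)" for i
    using abs_norm_eq_int_gen[OF I(1)[OF that(1)] P(2)[OF that(1)]] deg that by simp
  have cop_iff: "gcd (abs_norm L \<eta> (P i)) (abs_norm L \<eta> (P j)) = 1 \<longleftrightarrow> coprime (int_gen (P i)) (int_gen (P j))"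
    if "i < r" "j < r" "degree_one L \<eta> (P i)" "degree_one L \<eta> (P j)" for i j
    unfolding norm[OF that(1,3), symmetric] norm[OF that(2,4), symmetric] coprime_int_iff
    by (rule coprime_iff_gcd_eq_1[symmetric])
  have sub: "a \<subseteq> ideal_pow R (P i) (e i)" if "i < r" for i
    using ideal_factor_prod_subset[of r P i e] I(1) that unfolding fact by blast
  show ?thesis
  proof
    assume "degree_one L \<eta> a"
    then have cong: "\<And>x. x \<in> R \<Longrightarrow> \<exists>z::int. x - of_int z \<in> a" using degree_one_iff[OF a] by blast
    have aP: "a \<subseteq> P i" if i: "i < r" for i
      using sub[OF i] ideal_pow_antimono[OF I(1)[OF i], of "Suc 0" "e i"] e[OF i] ideal_pow_1[OF I(1)[OF i]] by auto
    have degP: "degree_one L \<eta> (P i)" if "i < r" for i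
      using deg[OF that] cong aP[OF that] by blast
    \<comment> \<open>An integer congruent to x modulo a lies in P i because a does. So, modulo a, P
      i is determined by its integer generator.\<close>
    have P_rep: "\<exists>z. int_gen (P i) dvd z \<and> x - of_int z \<in> a" if "i < r" "x \<in> P i" for i x
    proof -
      obtain z :: int where z: "x - of_int z \<in> a" using cong is_idealD(1)[OF I(1)] \<open>i < r\<close> \<open>x \<in> P i\<close> by blast
      then have "of_int z \<in> P i"
        using ideal_diff[OF I(1)[OF \<open>i < r\<close>] \<open>x \<in> P i\<close>, of "x - of_int z"] aP \<open>i < r\<close> by auto
      then show ?thesis using z of_int_in_ideal_iff[OF I(1)[OF that(1)] P(2)[OF that(1)]] by blast
    qed
    \<comment> \<open>With e i at least 2, a lies in the square of P i; if the integer generator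
      does too, \<open>P_rep\<close> puts all of P i there.\<close>
    have e1: "e i = 1" if i: "i < r" and ram: "ramified L \<eta> (P i)" for i
    proof (rule ccontr)
      assume "e i \<noteq> 1"
      then have "2 \<le> e i" using e[OF i] by simp
      let ?P2 = "ideal_mult R (P i) (P i)"
      have P2: "is_ideal R ?P2" using I(1)[OF i] is_ideal_mult by blast
      have a2: "a \<subseteq> ?P2"
        using sub[OF i] ideal_pow_antimono[OF I(1)[OF i] \<open>2 \<le> e i\<close>] ideal_pow_2[OF I(1)[OF i]] by auto
      have "of_int (int_gen (P i)) \<in> ?P2" using ramified_iff[OF P(1,2)[OF i]] ram by simp
      have "x \<in> ?P2" if x: "x \<in> P i" for x
      proof -
        obtain z where z: "int_gen (P i) dvd z" "x - of_int z \<in> a" using P_rep[OF i x] by blast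
        have "of_int z \<in> ?P2" by (rule ideal_int_mult[OF P2 \<open>of_int (int_gen (P i)) \<in> ?P2\<close> z(1)])
        then show ?thesis using is_idealD(3)[OF P2, of "x - of_int z" "of_int z"] a2 z(2) by auto
      qed
      then have "P i \<subseteq> ?P2" by blast
      then show False using prime_ideal_not_idempotent[OF P(1,2)[OF i]] by simp
    qed
    have cop: "coprime (int_gen (P i)) (int_gen (P j))" if ij: "i < r" "j < r" "i < j" for i j
    proof (rule ccontr)
      assume "\<not> coprime (int_gen (P i)) (int_gen (P j))"
      then have eq: "int_gen (P i) = int_gen (P j)"
        using primes_coprime[OF prime_int_gen[OF P(1,2)[OF ij(1)]] prime_int_gen[OF P(1,2)[OF ij(2)]]] by blast
      \<comment> \<open>Equal generators mean equal integers in the two primes, so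
        \<open>P_rep\<close> makes each prime contain the other.\<close>
      have "P k \<subseteq> P l" if kl: "k < r" "l < r" "int_gen (P k) = int_gen (P l)" for k l
      proof
        fix x assume "x \<in> P k"
        then obtain z where z: "int_gen (P k) dvd z" "x - of_int z \<in> a" using P_rep kl by blast
        then have "of_int z \<in> P l" using of_int_in_ideal_iff[OF I(1)[OF kl(2)] P(2)[OF kl(2)]] kl(3) by simp
        then show "x \<in> P l" using is_idealD(3)[OF I(1)[OF kl(2)], of "x - of_int z" "of_int z"] aP[OF kl(2)] z(2) by auto
      qed
      then show False using distinct ij eq by (metis nat_neq_iff subset_antisym)
    qed
    show "(\<forall>i<r. degree_one L \<eta> (P i) \<and> (ramified L \<eta> (P i) \<longrightarrow> e i = 1)) \<and>
      (\<forall>i<r. \<forall>j<r. i < j \<longrightarrow> gcd (abs_norm L \<eta> (P i)) (abs_norm L \<eta> (P j)) = 1)"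
    proof (intro conjI allI impI)
      fix i j assume ij: "i < r" "j < r" "i < j"
      then show "gcd (abs_norm L \<eta> (P i)) (abs_norm L \<eta> (P j)) = 1"
        using cop_iff[OF ij(1,2) degP[OF ij(1)] degP[OF ij(2)]] cop[OF ij] by blast
    qed (fact degP, fact e1)
  next
    assume *: "(\<forall>i<r. degree_one L \<eta> (P i) \<and> (ramified L \<eta> (P i) \<longrightarrow> e i = 1)) \<and>
      (\<forall>i<r. \<forall>j<r. i < j \<longrightarrow> gcd (abs_norm L \<eta> (P i)) (abs_norm L \<eta> (P j)) = 1)"
    have "of_int (\<Prod>i<r. int_gen (P i) ^ e i) \<in> ideal_factor_prod R P e r \<and>
      (\<forall>x\<in>R. \<exists>z::int. x - of_int z \<in> ideal_factor_prod R P e r)"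
    proof (rule ideal_factor_prod_cong_int)
      fix i x assume i: "i < r" and x: "x \<in> R"
      have 1: "\<exists>z::int. y - of_int z \<in> P i" if "y \<in> R" for y using * deg[OF i] i that by blast
      have 2: "of_int (int_gen (P i)) \<notin> ideal_mult R (P i) (P i)" if "e i > 1"
        using * i that ramified_iff[OF P(1,2)[OF i]] by force
      show "\<exists>z::int. x - of_int z \<in> ideal_pow R (P i) (e i)"
        by (rule ideal_pow_cong_int[OF P(1,2)[OF i] 1 2 x])
    next
      fix i j assume "j < i" "i < r"
      then show "coprime (int_gen (P j)) (int_gen (P i))" using * cop_iff[of j i] less_trans[of j i r] by blast
    qed (use I(1) int_gen_in P(2) in auto)
    then show "degree_one L \<eta> a" using degree_one_iff[OF a] unfolding fact by blast
  qed
qed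

end

subsection \<open>Values of integer polynomials modulo $n$\<close>

abbreviation ev :: "complex \<Rightarrow> int poly \<Rightarrow> complex" where
  "ev x g \<equiv> poly (map_poly of_int g) x"

lemma ev_simps [simp]:
  "ev x (- p) = - ev x p" "ev x (p + q) = ev x p + ev x q" "ev x (p - q) = ev x p - ev x q" "ev x (p * q) = ev x p * ev x q"
  "ev x (Polynomial.smult c p) = of_int c * ev x p" "ev x (p ^ k) = ev x p ^ k"
  "ev x (pCons c p) = of_int c + x * ev x p"
  by (simp_all add: hom_distribs of_int_hom.map_poly_pCons_hom)

lemma ev_sum: "ev x (\<Sum>i\<in>A. g i) = (\<Sum>i\<in>A. ev x (g i))"
  by (induction A rule: infinite_finite_induct) simp_all

text \<open>One Horner quotient serves integer arguments, complex arguments and the derivative;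
  applied again to the quotient, it yields a second-order Taylor expansion.\<close>

lemma linear_quotient:
  fixes g :: "int poly"
  obtains h where "\<And>w. poly g w = (w - v) * poly h w + poly g v"
    "\<And>x. ev x g = (x - of_int v) * ev x h + of_int (poly g v)"
    "poly (pderiv g) v = poly h v"
proof -
  define h where "h = synthetic_div g v"
  have eq: "[:- v, 1:] * h + [:poly g v:] = g"
    unfolding h_def by (rule synthetic_div_correct')
  have "poly g w = (w - v) * poly h w + poly g v" for w
    using arg_cong[OF eq, of "\<lambda>p. poly p w"] by (simp add: algebra_simps)
  moreover have "ev x g = (x - of_int v) * ev x h + of_int (poly g v)" for x
    using arg_cong[OF eq, of "ev x"] by (simp add: algebra_simps)
  moreover have "poly (pderiv g) v = poly h v"
  proof -
    have "pderiv ([:- v, 1:] * h + [:poly g v:]) = [:- v, 1:] * pderiv h + h"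
      unfolding pderiv_add pderiv_mult by (simp add: pderiv_pCons)
    then have "pderiv g = [:- v, 1:] * pderiv h + h" unfolding eq .
    then show ?thesis by simp
  qed
  ultimately show thesis using that by blast
qed

lemma dvd_poly_diff:
  fixes g :: "int poly"
  assumes "n dvd w - v" shows "n dvd poly g w - poly g v"
proof -
  obtain h where "poly g w = (w - v) * poly h w + poly g v" using linear_quotient[of g v] by metis
  then show ?thesis using assms by simp
qed

text \<open>Newton iteration with a composite modulus: a derivative that is a unit modulo
  \<open>n\<close> stays one at every \<open>w\<close> congruent to \<open>v\<close>.\<close>

lemma hensel_lift:
  fixes f :: "int poly"
  assumes "n dvd poly f v" "coprime (poly (pderiv f) v) n"
  shows "\<exists>w. n dvd w - v \<and> n ^ N dvd poly f w"
proof (induction N)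
  case 0 show ?case by (intro exI[of _ v]) simp
next
  case (Suc N)
  show ?case
  proof (cases "N = 0")
    \<comment> \<open>Doubling the exponent gains nothing from N = 0, so \<open>v\<close> itself is
      taken for exponent 1; afterwards 2 * N is at least N + 1.\<close>
    case True
    then show ?thesis using assms by (intro exI[of _ v]) simp
  next
    case False
    obtain w where w: "n dvd w - v" "n ^ N dvd poly f w" using Suc by blast
    have "n dvd poly (pderiv f) w - poly (pderiv f) v" using dvd_poly_diff[OF w(1)] .
    then have "c dvd poly (pderiv f) w \<Longrightarrow> c dvd n \<Longrightarrow> c dvd poly (pderiv f) v" for c
      by (meson dvd_trans dvd_diff_right_iff)
    then have "coprime (poly (pderiv f) w) n"
      using assms(2) by (meson coprimeI coprime_common_divisor)
    then obtain t s where ts: "t * poly (pderiv f) w + s * n = 1"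
      using bezout_int[of "poly (pderiv f) w" n] by auto
    \<comment> \<open>\<open>t\<close> inverts the derivative modulo n, so the linear term cancels
      f(w) up to a factor n.\<close>
    define d where "d = - poly f w * t"
    obtain h where h: "\<And>x. poly f x = (x - w) * poly h x + poly f w" "poly (pderiv f) w = poly h w"
      using linear_quotient[of f w] by metis
    obtain k where k: "\<And>x. poly h x = (x - w) * poly k x + poly h w"
      using linear_quotient[of h w] by metis
    have "poly f (w + d) = d * poly h (w + d) + poly f w" using h(1)[of "w + d"] by simp
    also have "poly h (w + d) = d * poly k (w + d) + poly h w" using k[of "w + d"] by simp
    also have "d * (d * poly k (w + d) + poly h w) + poly f w
        = poly f w * (1 - t * poly h w) + d * d * poly k (w + d)"
      by (simp add: d_def algebra_simps)
    also have "1 - t * poly h w = n * s" using ts h(2) by (simp add: algebra_simps)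
    finally have eq: "poly f (w + d) = poly f w * (n * s) + d * d * poly k (w + d)" .
    have nd: "n ^ N dvd d" using w(2) by (simp add: d_def)
    have "n ^ Suc N dvd n ^ (N + N)" using False by (intro le_imp_power_dvd) simp
    also have "\<dots> dvd d * d" unfolding power_add by (rule mult_dvd_mono[OF nd nd])
    finally have "n ^ Suc N dvd d * d * poly k (w + d)" by (rule dvd_mult2)
    moreover have "n ^ Suc N dvd poly f w * (n * s)"
      using mult_dvd_mono[OF w(2), of n "n * s"] by (simp add: mult.commute)
    ultimately have "n ^ Suc N dvd poly f (w + d)" unfolding eq by (rule dvd_add[rotated])
    moreover have "n dvd d" using nd False by (meson dvd_power dvd_trans not_gr_zero)
    then have "n dvd w + d - v" using w(1) by (metis add_diff_eq add.commute dvd_add)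
    ultimately show ?thesis by blast
  qed
qed

text \<open>The Sylvester matrix sends the vector of descending powers of \<open>v\<close> to
  multiples of f(v) and g(v). The adjugate then gives the determinant times that vector, whose last
  entry is 1.\<close>

lemma dvd_resultant:
  fixes f g :: "'a :: comm_ring_1 poly"
  assumes deg: "degree f + degree g > 0" and c: "c dvd poly f v" "c dvd poly g v"
  shows "c dvd resultant f g"
proof -
  define N where "N = degree f + degree g"
  define S where "S = sylvester_mat f g"
  define x where "x = vec N (\<lambda>j. v ^ (N - 1 - j))"
  have S: "S \<in> carrier_mat N N" by (simp add: S_def N_def sylvester_carrier_mat)
  have x: "x \<in> carrier_vec N" by (simp add: x_def)
  \<comment> \<open>In \<open>sylvester_index_mat2\<close> the monomial exponent and the coefficient
    index are both one higher than those matching \<open>x\<close>; lowering them together keeps the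
    entry.\<close>
  have shift: "coeff (monom 1 (Suc a) * p) (Suc b) = coeff (monom 1 a * p) b" for a b and p :: "'a poly"
    by (simp add: coeff_monom_mult)
  have row: "(\<Sum>j<N. coeff (monom 1 a * p) (N - 1 - j) * v ^ (N - 1 - j)) = v ^ a * poly p v"
    if "a + degree p < N" for a and p :: "'a poly"
  proof -
    have "degree (monom 1 a * p) < N"
      using degree_mult_le[of "monom 1 a" p] degree_monom_le[of 1 a] that by (meson add_le_mono1 le_trans not_le)
    have "(\<Sum>j<N. coeff (monom 1 a * p) (N - 1 - j) * v ^ (N - 1 - j)) = (\<Sum>j<N. coeff (monom 1 a * p) j * v ^ j)"
      using sum.nat_diff_reindex[of "\<lambda>j. coeff (monom 1 a * p) j * v ^ j" N] by simp
    also have "\<dots> = (\<Sum>j\<le>degree (monom 1 a * p). coeff (monom 1 a * p) j * v ^ j)"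
      using \<open>degree (monom 1 a * p) < N\<close> by (intro sum.mono_neutral_right) (auto simp: coeff_eq_0)
    also have "\<dots> = poly (monom 1 a * p) v" by (simp add: poly_altdef)
    finally show ?thesis by (simp add: poly_monom)
  qed
  have dvd: "c dvd (S *\<^sub>v x) $ i" if i: "i < N" for i
  proof -
    have Sx: "(S *\<^sub>v x) $ i = (\<Sum>j<N. S $$ (i,j) * v ^ (N - 1 - j))"
      using i S by (auto simp: scalar_prod_def x_def lessThan_atLeast0 intro!: sum.cong)
    have Sij: "S $$ (i,j) = (if i < degree g then coeff (monom 1 (degree g - 1 - i) * f) (N - 1 - j)
        else coeff (monom 1 (N - 1 - i) * g) (N - 1 - j))" if j: "j < N" for j
    proof -
      have "N - j = Suc (N - 1 - j)" "N - i = Suc (N - 1 - i)" using i j by simp_all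
      moreover have "degree g - i = Suc (degree g - 1 - i)" if "i < degree g" using that by simp
      ultimately show ?thesis
        unfolding S_def using sylvester_index_mat2[of i f g j] i j
        by (auto simp: shift simp flip: N_def)
    qed
    show ?thesis
    proof (cases "i < degree g")
      case True
      then have "(S *\<^sub>v x) $ i = v ^ (degree g - 1 - i) * poly f v"
        unfolding Sx using Sij row[of "degree g - 1 - i" f] by (simp add: N_def)
      then show ?thesis using c(1) by simp
    next
      case False
      then have "(S *\<^sub>v x) $ i = v ^ (N - 1 - i) * poly g v"
        unfolding Sx using Sij row[of "N - 1 - i" g] i by (simp add: N_def)
      then show ?thesis using c(2) by simp
    qed
  qed
  have "(adj_mat S * S) *\<^sub>v x = adj_mat S *\<^sub>v (S *\<^sub>v x)"
    using adj_mat(1)[OF S] S x by (rule assoc_mult_mat_vec)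
  moreover have "((adj_mat S * S) *\<^sub>v x) $ (N - 1) = det S"
  proof -
    have "(adj_mat S * S) *\<^sub>v x = det S \<cdot>\<^sub>v x"
      unfolding adj_mat(3)[OF S] using x by (intro eq_vecI) (auto simp: row_one)
    then show ?thesis using deg by (simp add: x_def N_def)
  qed
  moreover have "c dvd (adj_mat S *\<^sub>v (S *\<^sub>v x)) $ (N - 1)"
  proof -
    have "(adj_mat S *\<^sub>v (S *\<^sub>v x)) $ (N - 1) = (\<Sum>i<N. adj_mat S $$ (N - 1, i) * (S *\<^sub>v x) $ i)"
      using deg S adj_mat(1)[OF S] by (auto simp: scalar_prod_def lessThan_atLeast0 N_def intro!: sum.cong)
    then show ?thesis using dvd by (auto intro!: dvd_sum)
  qed
  ultimately show ?thesis by (simp add: resultant_def S_def)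
qed

text \<open>The first column of the Sylvester matrix has only the two nonzero entries
  $\mathrm{lc}(f)$ and $\deg(f)\,\mathrm{lc}(f)$.\<close>

lemma lead_coeff_dvd_resultant_pderiv:
  fixes f :: "int poly"
  assumes "degree f > 0"
  shows "lead_coeff f dvd resultant f (pderiv f)"
proof -
  let ?g = "pderiv f" and ?N = "degree f + degree (pderiv f)"
  have deg: "degree ?g = degree f - 1" by (rule degree_pderiv)
  let ?S = "sylvester_mat f ?g"
  have S: "?S \<in> carrier_mat ?N ?N" by (rule sylvester_carrier_mat)
  have "lead_coeff f dvd ?S $$ (i, 0)" if i: "i < ?N" for i
  proof -
    have "lead_coeff f dvd lead_coeff ?g"
      using assms by (simp add: deg coeff_pderiv)
    then show ?thesis
      using sylvester_index_mat[of i f ?g 0] i assms by auto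
  qed
  moreover have "det ?S = (\<Sum>i<?N. ?S $$ (i,0) * cofactor ?S i 0)"
    using laplace_expansion_column[OF S, of 0] assms by simp
  ultimately show ?thesis unfolding resultant_def by (auto intro!: dvd_sum)
qed

text \<open>Pseudo-division stays over the integers. Minimality of the degree kills the remainder,
  and by Gauss's lemma the factor \<open>c\<close> can be cancelled because \<open>f\<close> is
  primitive.\<close>

lemma min_poly_dvd:
  assumes f: "primitive_min_poly \<alpha> f" and G: "ev \<alpha> G = 0"
  shows "f dvd G"
proof -
  have f0: "f \<noteq> 0" and ev0: "ev \<alpha> f = 0" and cont: "content f = 1"
    and min: "\<And>g. g \<noteq> 0 \<Longrightarrow> ev \<alpha> g = 0 \<Longrightarrow> degree f \<le> degree g"
    using f by (auto simp: primitive_min_poly_def)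
  obtain q r where qr: "pseudo_divmod G f = (q, r)" by (meson surj_pair)
  define c where "c = lead_coeff f ^ (Suc (degree G) - degree f)"
  have eq: "Polynomial.smult c G = f * q + r" and r: "r = 0 \<or> degree r < degree f"
    using pseudo_divmod[OF f0 qr] by (auto simp: c_def)
  have c: "c \<noteq> 0" using f0 by (simp add: c_def)
  have "ev \<alpha> r = 0" using arg_cong[OF eq, of "ev \<alpha>"] ev0 G by simp
  then have "r = 0" using r min[of r] by (metis not_le)
  then have eq: "Polynomial.smult c G = f * q" using eq by simp
  then have "content (Polynomial.smult c G) = content q" using cont by (simp add: content_mult)
  then have "c dvd content q" by (metis content_smult dvd_triv_left normalize_dvd_iff)
  then have "[:c:] dvd q" by (simp add: const_poly_dvd_iff_dvd_content)
  then obtain q' where "q = Polynomial.smult c q'" by (auto elim!: dvdE)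
  then have "Polynomial.smult c G = Polynomial.smult c (f * q')" using eq by simp
  then have "G = f * q'" using c by (metis smult_cancel)
  then show ?thesis by simp
qed

text \<open>Reducing $g(\alpha)/q$ at a root of $f$ modulo a high power of $q$: integrality of $g(\alpha)/q$
  forces $q$ to divide the value there.\<close>

lemma integral_quotient_value:
  assumes f: "primitive_min_poly \<alpha> f" and y: "algebraic_integer y"
    and q: "q > 0" and g: "of_int q * y = ev \<alpha> g"
  shows "\<exists>m. \<forall>v. q ^ m dvd poly f v \<longrightarrow> q dvd poly g v"
proof -
  obtain F :: "int poly" where F: "lead_coeff F = 1" "ev y F = 0"
    using y by (auto simp: algebraic_integer_def)
  define m where "m = degree F"
  have m: "m > 0"
  proof (rule ccontr)
    assume "\<not> m > 0"
    then obtain a where "F = [:a:]" using degree_eq_zeroE[of F] unfolding m_def by blast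
    then show False using F by simp
  qed
  \<comment> \<open>The homogenized form q ^ m * F(g / q), so that G vanishes at \<alpha> and
    \<open>f\<close> divides it.\<close>
  define G where "G = (\<Sum>i\<le>m. Polynomial.smult (coeff F i * q ^ (m - i)) (g ^ i))"
  have "ev \<alpha> G = (\<Sum>i\<le>m. of_int q ^ m * (of_int (coeff F i) * y ^ i))"
    unfolding G_def ev_sum
  proof (rule sum.cong)
    fix i assume "i \<in> {..m}"
    then have "(of_int q :: complex) ^ m = of_int q ^ (m - i) * of_int q ^ i"
      by (simp flip: power_add)
    then show "ev \<alpha> (Polynomial.smult (coeff F i * q ^ (m - i)) (g ^ i)) = of_int q ^ m * (of_int (coeff F i) * y ^ i)"
      by (simp add: g[symmetric] power_mult_distrib)
  qed simp
  also have "\<dots> = of_int q ^ m * ev y F"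
    by (simp add: poly_altdef m_def sum_distrib_left)
  finally have "f dvd G" using min_poly_dvd[OF f] F(2) by simp
  have "q dvd poly g v" if v: "q ^ m dvd poly f v" for v
  proof -
    \<comment> \<open>Divisibility of f(v) by q ^ m makes F(W) an integer e. Then W is a rational
      root of F - e, still monic as m > 0, and therefore an integer.\<close>
    define W :: real where "W = of_int (poly g v) / of_int q"
    have "poly f v dvd poly G v" using \<open>f dvd G\<close> by (auto elim!: dvdE)
    then have "q ^ m dvd poly G v" using v dvd_trans by blast
    then obtain e where e: "poly G v = q ^ m * e" by blast
    have "real_of_int (poly G v) = (\<Sum>i\<le>m. of_int q ^ m * (of_int (coeff F i) * W ^ i))"
      unfolding G_def poly_sum of_int_sum
    proof (rule sum.cong)
      fix i assume "i \<in> {..m}"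
      then have "(of_int q :: real) ^ m = of_int q ^ (m - i) * of_int q ^ i"
        by (simp flip: power_add)
      then show "real_of_int (poly (Polynomial.smult (coeff F i * q ^ (m - i)) (g ^ i)) v) = of_int q ^ m * (of_int (coeff F i) * W ^ i)"
        using q by (simp add: W_def power_divide)
    qed simp
    also have "\<dots> = of_int q ^ m * poly (map_poly of_int F) W"
      by (simp add: poly_altdef m_def sum_distrib_left)
    finally have "of_int q ^ m * real_of_int e = of_int q ^ m * poly (map_poly of_int F) W"
      using e by simp
    then have "poly (map_poly of_int F) W = of_int e" using q by simp
    then have "poly (map_poly of_int (F - [:e:])) W = 0" by (simp add: hom_distribs of_int_hom.map_poly_pCons_hom)
    moreover have "lead_coeff (F - [:e:]) = 1"
    proof -
      have "degree (F - [:e:]) = degree F"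
        unfolding diff_conv_add_uminus using m by (intro degree_add_eq_left) (simp add: m_def)
      then show ?thesis using F(1) m by (cases "degree F") (auto simp: m_def)
    qed
    ultimately have "algebraic_int W" unfolding algebraic_int_altdef_ipoly by blast
    moreover have "W \<in> \<rat>" by (simp add: W_def)
    ultimately have "W \<in> \<int>" by (rule rational_algebraic_int_is_int)
    then obtain z where "W = of_int z" by (auto elim: Ints_cases)
    then have "real_of_int (poly g v) = real_of_int (q * z)" using q by (simp add: W_def field_simps)
    then have "poly g v = q * z" by linarith
    then show ?thesis by simp
  qed
  then show ?thesis by blast
qed

text \<open>The gcd with \<open>n\<close> is stripped off until the rest is prime to
  \<open>n\<close>; each stripping makes D strictly smaller.\<close>

lemma split_coprime_part:
  fixes D n :: int
  assumes "D > 0"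
  shows "\<exists>D1 D2 s. D = D1 * D2 \<and> coprime D1 n \<and> D2 dvd n ^ s"
  using assms
proof (induction "nat D" arbitrary: D rule: less_induct)
  case less
  show ?case
  proof (cases "coprime D n")
    case True
    then show ?thesis by (intro exI[of _ D] exI[of _ 1]) auto
  next
    case False
    define c where "c = gcd D n"
    have "c \<noteq> 1" using False by (simp add: c_def coprime_iff_gcd_eq_1)
    moreover have "c > 0" using less.prems by (simp add: c_def)
    ultimately have c: "c > 1" by simp
    obtain D' where D': "D = c * D'" using gcd_dvd1[of D n] unfolding c_def by blast
    have "D' > 0" using D' less.prems c by (simp add: zero_less_mult_iff)
    moreover have "D' < D" using D' c \<open>D' > 0\<close> by simp
    ultimately obtain D1 D2 s where IH: "D' = D1 * D2" "coprime D1 n" "D2 dvd n ^ s"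
      using less.hyps[of D'] by auto
    have "c * D2 dvd n * n ^ s" using IH(3) by (intro mult_dvd_mono) (simp_all add: c_def)
    then show ?thesis using IH D' by (intro exI[of _ D1] exI[of _ "c * D2"] exI[of _ "Suc s"]) auto
  qed
qed

context localized_integers
begin

subsection \<open>Degree one ideals from roots modulo $n$\<close>

text \<open>The fractions g(\<alpha>) / D in \<open>L\<close> form a subfield containing \<alpha>,
  and \<open>Q_adjoin\<close> is the smallest one.\<close>

lemma number_field_eq_polys:
  assumes \<alpha>: "\<alpha> \<in> L" and gen: "L = Q_adjoin \<alpha>" and y: "y \<in> L"
  shows "\<exists>(D::int) g. D > 0 \<and> of_int D * y = ev \<alpha> g"
proof -
  define K where "K = {y \<in> L. \<exists>(D::int) g. D > 0 \<and> of_int D * y = ev \<alpha> g}"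
  have KI: "y \<in> K" if "y \<in> L" "D > 0" "of_int D * y = ev \<alpha> g" for y D g
    using that unfolding K_def by blast
  have add: "x + y \<in> K" and mult: "x * y \<in> K" if xy: "x \<in> K" "y \<in> K" for x y
  proof -
    obtain D g E h where Dg: "D > 0" "of_int D * x = ev \<alpha> g" and Eh: "E > 0" "of_int E * y = ev \<alpha> h"
      and L: "x \<in> L" "y \<in> L" using xy unfolding K_def by blast
    have "of_int (D * E) * (x + y) = of_int E * (of_int D * x) + of_int D * (of_int E * y)"
      by (simp add: algebra_simps)
    also have "\<dots> = ev \<alpha> (Polynomial.smult E g + Polynomial.smult D h)" using Dg Eh by simp
    finally show "x + y \<in> K" using Dg(1) Eh(1) L L_add       by (intro KI[of "x + y" "D * E" "Polynomial.smult E g + Polynomial.smult D h"]) auto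
    have "of_int (D * E) * (x * y) = (of_int D * x) * (of_int E * y)" by simp
    also have "\<dots> = ev \<alpha> (g * h)" using Dg Eh by simp
    finally show "x * y \<in> K" using Dg(1) Eh(1) L L_mult       by (intro KI[of "x * y" "D * E" "g * h"]) auto
  qed
  have int: "of_int a \<in> K" for a by (rule KI[of _ 1 "[:a:]"]) simp_all
  have poly: "ev x q \<in> K" if x: "x \<in> K" for x and q :: "int poly"
    by (induction q) (use int[of 0] in \<open>auto intro: add mult x int\<close>)
  have inv: "inverse x \<in> K" if x: "x \<in> K" "x \<noteq> 0" for x
  proof -
    have "x \<in> L" using x by (simp add: K_def)
    then obtain D :: int where D: "D > 0" "algebraic_integer (of_int D * x)"
      using number_field_denominator[OF number_field] by blast
    let ?w = "of_int D * x"
    obtain p :: "int poly" where "p \<noteq> 0" "ev ?w p = 0"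
      using D(2) unfolding algebraic_integer_def by (metis leading_coeff_0_iff zero_neq_one)
    moreover have "?w \<noteq> 0" using D(1) x by simp
    ultimately obtain q :: "int poly" where q: "coeff q 0 \<noteq> 0" "ev ?w q = 0"
      using nonzero_constant_coeff by blast
    obtain a q' where "q = pCons a q'" by (cases q)
    then have a: "a \<noteq> 0" "of_int a + ?w * ev ?w q' = 0" using q by simp_all
    \<comment> \<open>Dividing this equation by x expresses a / x through a polynomial in D * x,
      which is already in \<open>K\<close>.\<close>
    have "of_int a = - (?w * ev ?w q')" using a(2) by (simp only: eq_neg_iff_add_eq_0)
    then have "of_int a * inverse x = of_int (- D) * ev ?w q'" using x(2) by simp
    moreover have "inverse x = of_int a * inverse x * inverse (of_int a)" using a(1) by simp
    ultimately have eq: "inverse x = of_int (- D) * ev ?w q' * inverse (of_int a)" by metis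
    have "inverse (of_int a) \<in> K"
    proof (rule KI)
      show "inverse (of_int a) \<in> L" using subfield a(1) L_of_int unfolding is_subfield_def by auto
      show "\<bar>a\<bar> > 0" using a(1) by simp
      show "of_int \<bar>a\<bar> * inverse (of_int a) = ev \<alpha> [:sgn a:]"
        using a(1) by (auto simp: abs_if sgn_if)
    qed
    then show ?thesis unfolding eq using mult int poly x(1) by blast
  qed
  have "is_subfield K"
    unfolding is_subfield_def
    using int[of 0] int[of 1] add mult inv mult[OF int[of "-1"]] by auto
  moreover have "\<alpha> \<in> K" using \<alpha> by (intro KI[of \<alpha> 1 "[:0,1:]"]) auto
  ultimately have "L \<subseteq> K" unfolding gen Q_adjoin_def by blast
  then show ?thesis using y unfolding K_def by blast
qed

lemma ideal_gen_pair:
  assumes "a \<in> R" "b \<in> R" "x \<in> ideal_gen R {a, b}"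
  obtains r s where "r \<in> R" "s \<in> R" "x = a * r + b * s"
proof -
  let ?J = "{a * r + b * s | r s. r \<in> R \<and> s \<in> R}"
  have J: "y \<in> ?J" if "r \<in> R" "s \<in> R" "y = a * r + b * s" for y r s using that by blast
  have "is_ideal R ?J"
    unfolding is_ideal_def
  proof (intro conjI ballI)
    show "?J \<subseteq> R" using assms(1,2) R_add R_mult by auto
    show "0 \<in> ?J" by (rule J[of 0 0]) simp_all
    fix x assume "x \<in> ?J"
    then obtain r s where rs: "r \<in> R" "s \<in> R" "x = a * r + b * s" by blast
    {
      fix y assume "y \<in> ?J"
      then obtain r' s' where "r' \<in> R" "s' \<in> R" "y = a * r' + b * s'" by blast
      then show "x + y \<in> ?J" using rs R_add by (intro J[of "r + r'" "s + s'"]) (auto simp: algebra_simps)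
    next
      fix t assume "t \<in> R"
      then show "t * x \<in> ?J" using rs R_mult by (intro J[of "t * r" "t * s"]) (auto simp: algebra_simps)
    }
  qed
  moreover have "{a, b} \<subseteq> ?J" using J[of 1 0 a] J[of 0 1 b] by simp
  ultimately have "ideal_gen R {a, b} \<subseteq> ?J" by (rule ideal_gen_subset)
  then show thesis using assms(3) that by blast
qed


context
  fixes \<alpha> :: complex and f :: "int poly" and n :: int
  assumes \<alpha>: "\<alpha> \<in> R" and gen: "L = Q_adjoin \<alpha>" and f: "primitive_min_poly \<alpha> f"
    and n: "n \<ge> 2" and cop: "coprime n (int \<eta> * poly_discriminant f)"
begin

lemma ev_f: "ev \<alpha> f = 0" and f_nonzero: "f \<noteq> 0"
  using f by (auto simp: primitive_min_poly_def)

lemma degree_f: "degree f > 0"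
proof (rule ccontr)
  assume "\<not> degree f > 0"
  then obtain a where "f = [:a:]" using degree_eq_zeroE[of f] by blast
  then show False using ev_f f_nonzero by simp
qed

lemma coprime_n_eta: "coprime n (int \<eta>)"
  using cop by simp

text \<open>Since $\eta^k \alpha$ is integral, the primes dividing $\mathrm{lc}(f)$ divide $\eta$.\<close>

lemma coprime_n_lead_coeff: "coprime n (lead_coeff f)"
proof -
  obtain k where "algebraic_integer (of_nat \<eta> ^ k * \<alpha>)" using \<alpha> R_iff by blast
  then obtain p :: "int poly" where p: "lead_coeff p = 1" "ev (of_nat \<eta> ^ k * \<alpha>) p = 0"
    by (auto simp: algebraic_integer_def)
  define l where "l = [:0, int \<eta> ^ k:]"
  have l: "degree l = 1" "lead_coeff l = int \<eta> ^ k" using eta_pos by (simp_all add: l_def)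
  have "ev \<alpha> (pcompose p l) = 0"
    unfolding poly_of_int_pcompose using p(2) by (simp add: l_def mult.commute)
  then have "f dvd pcompose p l" by (rule min_poly_dvd[OF f])
  then obtain q where "pcompose p l = f * q" by blast
  then have "lead_coeff f dvd lead_coeff (pcompose p l)" by (simp only: lead_coeff_mult dvd_triv_left)
  moreover have "lead_coeff (pcompose p l) = (int \<eta> ^ k) ^ degree p"
    using lead_coeff_comp[of l p] l p(1) by simp
  moreover have "coprime n ((int \<eta> ^ k) ^ degree p)" using coprime_n_eta by simp
  ultimately show ?thesis by (metis coprime_divisors dvd_refl)
qed

text \<open>A common divisor of f'(v) and n divides the resultant, which up to sign is the leading
  coefficient times the discriminant, both prime to n.\<close>

lemma coprime_pderiv:
  assumes "n dvd poly f v" shows "coprime (poly (pderiv f) v) n"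
proof (rule coprimeI)
  fix c assume c: "c dvd poly (pderiv f) v" "c dvd n"
  have "c dvd poly f v" using c(2) assms by (rule dvd_trans)
  then have "c dvd resultant f (pderiv f)" using dvd_resultant[OF _ _ c(1)] degree_f by simp
  moreover have "resultant f (pderiv f) = lead_coeff f * (resultant f (pderiv f) div lead_coeff f)"
    using lead_coeff_dvd_resultant_pderiv[OF degree_f] by simp
  moreover have "coprime n (resultant f (pderiv f) div lead_coeff f)"
    using cop by (simp add: poly_discriminant_def)
  then have "coprime n (lead_coeff f * (resultant f (pderiv f) div lead_coeff f))"
    using coprime_n_lead_coeff by simp
  ultimately show "is_unit c" using c(2) by (metis coprime_common_divisor)
qed

text \<open>Separates the part \<open>D\<close> of the denominator that is invertible modulo
  \<open>n\<close> from the power of \<open>n\<close> that must be cancelled by lifting.\<close>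

lemma R_poly_denominator:
  assumes y: "y \<in> R"
  shows "\<exists>(D::int) s g. D > 0 \<and> coprime D n \<and> of_int (n ^ s) * (of_int D * y) = ev \<alpha> g"
proof -
  obtain E :: int and g where E: "E > 0" "of_int E * y = ev \<alpha> g"
    using number_field_eq_polys[OF R_subset_L[OF \<alpha>] gen R_subset_L[OF y]] by blast
  obtain D1 D2 s where D: "E = D1 * D2" "coprime D1 n" "D2 dvd n ^ s"
    using split_coprime_part[OF E(1)] by blast
  obtain c where c: "n ^ s = D2 * c" using D(3) by blast
  have "of_int (n ^ s) * (of_int D1 * y) = of_int c * (of_int E * y)" unfolding c D(1) by simp
  also have "\<dots> = ev \<alpha> (Polynomial.smult c g)" using E(2) by simp
  finally have eq: "of_int (n ^ s) * (of_int D1 * y) = ev \<alpha> (Polynomial.smult c g)" .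
  show ?thesis
  \<comment> \<open>\<open>split_coprime_part\<close> leaves the signs of the factors open; a
    negative D1 is negated together with the polynomial.\<close>
  proof (cases "D1 > 0")
    case True
    then show ?thesis using eq D(2) by blast
  next
    case False
    then have "D1 < 0" using E(1) D(1) by (cases "D1 = 0") auto
    moreover have "of_int (n ^ s) * (of_int (- D1) * y) = ev \<alpha> (Polynomial.smult (- c) g)" using eq by simp
    moreover have "coprime (- D1) n" using D(2) by simp
    ultimately show ?thesis by (meson neg_0_less_iff_less)
  qed
qed

text \<open>A power of \<eta> makes \<open>y\<close> integral, so the integral case applies; that
  power is prime to \<open>n\<close> and cancels from the divisibility.\<close>

lemma R_quotient_value:
  assumes y: "y \<in> R" and g: "of_int (n ^ s) * y = ev \<alpha> g"
  shows "\<exists>N. \<forall>v. n ^ N dvd poly f v \<longrightarrow> n ^ s dvd poly g v"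
proof -
  obtain k where k: "algebraic_integer (of_nat \<eta> ^ k * y)" using y R_iff by blast
  have "of_int (n ^ s) * (of_nat \<eta> ^ k * y) = ev \<alpha> (Polynomial.smult (int \<eta> ^ k) g)"
    using g by (simp add: mult.left_commute)
  then obtain m where m: "\<forall>v. (n ^ s) ^ m dvd poly f v \<longrightarrow> n ^ s dvd poly (Polynomial.smult (int \<eta> ^ k) g) v"
    using integral_quotient_value[OF f k] n by (metis less_le_trans zero_less_numeral zero_less_power)
  have "n ^ s dvd poly g v" if "n ^ (s * m) dvd poly f v" for v
  proof -
    have "n ^ s dvd int \<eta> ^ k * poly g v" using m that by (simp add: power_mult)
    moreover have "coprime (n ^ s) (int \<eta> ^ k)" using coprime_n_eta by simp
    ultimately show ?thesis by (simp add: coprime_dvd_mult_right_iff)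
  qed
  then show ?thesis by blast
qed

section \<open>The ideal attached to a root of f modulo n\<close>

context
  fixes v :: int
  assumes v: "n dvd poly f v"
begin

definition root_ideal :: "complex set" where
  "root_ideal = ideal_gen R {\<alpha> - of_int v, of_int n}"

lemma is_ideal_root_ideal: "is_ideal R root_ideal"
  and n_in_root_ideal: "of_int n \<in> root_ideal" and diff_in_root_ideal: "\<alpha> - of_int v \<in> root_ideal"
  unfolding root_ideal_def using subset_ideal_gen[of "{\<alpha> - of_int v, of_int n}" R]
  by (auto intro!: is_ideal_gen R_diff \<alpha>)

lemma lift_root:
  obtains w where "n dvd w - v" "n ^ N dvd poly f w"
  using hensel_lift[OF v coprime_pderiv[OF v]] by blast

text \<open>With $f = (x - w) h + f(w)$, the element $h(\alpha)$ annihilates $\alpha - w$ modulo a high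
  power of $n$ and is congruent to the unit $f'(w)$ modulo the ideal.\<close>

lemma root_ideal_cong_int:
  assumes y: "y \<in> R" shows "\<exists>z::int. y - of_int z \<in> root_ideal"
proof -
  note I = is_ideal_root_ideal
  obtain D :: int and s g where D: "coprime D n" "of_int (n ^ s) * (of_int D * y) = ev \<alpha> g"
    using R_poly_denominator[OF y] by blast
  have DyR: "of_int D * y \<in> R" using y R_mult by simp
  obtain N where N: "\<And>w. n ^ N dvd poly f w \<Longrightarrow> n ^ s dvd poly g w"
    using R_quotient_value[OF DyR D(2)] by blast
  \<comment> \<open>\<open>N\<close> makes g(w) divisible by n ^ s; \<open>Suc s\<close> leaves one
    factor n in f(w) after n ^ s is cancelled.\<close>
  obtain w where w: "n dvd w - v" "n ^ (N + Suc s) dvd poly f w" using lift_root by blast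
  have "n ^ N dvd poly f w" using w(2) by (metis power_le_dvd le_add1)
  then obtain q where q: "poly g w = n ^ s * q" using N by blast
  have "n ^ Suc s dvd poly f w" using w(2) by (metis power_le_dvd le_add2)
  then obtain c where c: "poly f w = n ^ Suc s * c" by blast
  obtain h where h: "ev \<alpha> f = (\<alpha> - of_int w) * ev \<alpha> h + of_int (poly f w)" "poly (pderiv f) w = poly h w"
    using linear_quotient[of f w] by metis
  obtain k where k: "ev \<alpha> g = (\<alpha> - of_int w) * ev \<alpha> k + of_int (poly g w)"
    using linear_quotient[of g w] by metis
  obtain j where j: "ev \<alpha> h = (\<alpha> - of_int w) * ev \<alpha> j + of_int (poly h w)"
    using linear_quotient[of h w] by metis
  have R: "ev \<alpha> p \<in> R" for p using R_poly[OF \<alpha>] .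
  have \<alpha>w: "\<alpha> - of_int w \<in> root_ideal"
    using ideal_diff[OF I diff_in_root_ideal ideal_int_mult[OF I n_in_root_ideal w(1)]] by simp
  have n0: "(of_int n :: complex) \<noteq> 0" using n by simp
  let ?e = "of_int D * y - of_int q"
  have "(of_int n :: complex) ^ s * (ev \<alpha> h * ?e) = ev \<alpha> h * (ev \<alpha> g - of_int (poly g w))"
    unfolding D(2)[symmetric] q by (simp add: algebra_simps)
  also have "\<dots> = (\<alpha> - of_int w) * ev \<alpha> h * ev \<alpha> k" using k by simp
  also have "(\<alpha> - of_int w) * ev \<alpha> h = - of_int (poly f w)"
    using h(1) ev_f by (simp add: eq_neg_iff_add_eq_0)
  also have "- of_int (poly f w) * ev \<alpha> k = of_int n ^ s * (of_int n * (- of_int c * ev \<alpha> k))"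
    unfolding c by simp
  finally have "ev \<alpha> h * ?e = of_int n * (- of_int c * ev \<alpha> k)"
    using mult_left_cancel[OF power_not_zero[OF n0, of s]] by blast
  moreover have "of_int n * (- of_int c * ev \<alpha> k) \<in> root_ideal"
    using R R_uminus R_mult by (intro ideal_mult_right[OF I n_in_root_ideal]) auto
  ultimately have he: "ev \<alpha> h * ?e \<in> root_ideal" by simp
  have eR: "?e \<in> R" using DyR R_diff by simp
  \<comment> \<open>Modulo the ideal, h(\<alpha>) may be replaced by the integer h(w), which is
    f'(w).\<close>
  have "(\<alpha> - of_int w) * (ev \<alpha> j * ?e) \<in> root_ideal"
    using R eR R_mult by (intro ideal_mult_right[OF I \<alpha>w]) auto
  from ideal_diff[OF I he this] have "of_int (poly h w) * ?e \<in> root_ideal"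
    unfolding j by (simp add: algebra_simps)
  have "n dvd poly f w" using c by simp
  then have "coprime (poly h w) n" using coprime_pderiv h(2) by metis
  then have "coprime (poly h w * D) n" using D(1) by simp
  then obtain u t where ut: "u * (poly h w * D) + t * n = 1"
    using bezout_int[of "poly h w * D" n] by auto
  have "of_int u * (of_int (poly h w) * ?e) + of_int n * (of_int t * y) \<in> root_ideal"
    using \<open>of_int (poly h w) * ?e \<in> root_ideal\<close> R_mult[OF R_of_int y]
    by (intro is_idealD(3)[OF I is_idealD(4)[OF I R_of_int] ideal_mult_right[OF I n_in_root_ideal]])
  also have "of_int u * (of_int (poly h w) * ?e) + of_int n * (of_int t * y)
      = of_int (u * (poly h w * D) + t * n) * y - of_int (u * (poly h w * q))"
    by (simp add: algebra_simps)
  finally show ?thesis unfolding ut of_int_1 mult_1 by blast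
qed

text \<open>The relation z = (\<alpha> - v) * A + n * B, cleared of denominators, is a polynomial
  identity modulo f. At a lifted root both terms on the right are divisible by n ^ (r + 1), while
  the left side is n ^ r * D * E * z.\<close>

lemma of_int_in_root_ideal:
  assumes "of_int z \<in> root_ideal" shows "n dvd z"
proof -
  obtain A B where AB: "A \<in> R" "B \<in> R" "of_int z = (\<alpha> - of_int v) * A + of_int n * B"
    using ideal_gen_pair[OF R_diff[OF \<alpha> R_of_int] R_of_int] assms unfolding root_ideal_def by blast
  obtain D s a where D: "coprime D n" "of_int (n ^ s) * (of_int D * A) = ev \<alpha> a"
    using R_poly_denominator[OF AB(1)] by blast
  obtain E t b where E: "coprime E n" "of_int (n ^ t) * (of_int E * B) = ev \<alpha> b"
    using R_poly_denominator[OF AB(2)] by blast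
  define r where "r = s + t"
  define a' where "a' = Polynomial.smult (E * n ^ t) a"
  define b' where "b' = Polynomial.smult (D * n ^ s) b"
  let ?A = "of_int (D * E) * A" and ?B = "of_int (D * E) * B"
  have R: "?A \<in> R" "?B \<in> R" using AB R_mult R_of_int by blast+
  have "of_int (n ^ r) * ?A = of_int (E * n ^ t) * (of_int (n ^ s) * (of_int D * A))"
    by (simp add: r_def power_add)
  also have "\<dots> = ev \<alpha> a'" unfolding D(2) by (simp add: a'_def)
  finally have a': "of_int (n ^ r) * ?A = ev \<alpha> a'" .
  have "of_int (n ^ r) * ?B = of_int (D * n ^ s) * (of_int (n ^ t) * (of_int E * B))"
    by (simp add: r_def power_add)
  also have "\<dots> = ev \<alpha> b'" unfolding E(2) by (simp add: b'_def)
  finally have b': "of_int (n ^ r) * ?B = ev \<alpha> b'" .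
  obtain N where N: "\<And>w. n ^ N dvd poly f w \<Longrightarrow> n ^ r dvd poly a' w"
    using R_quotient_value[OF R(1) a'] by blast
  obtain M where M: "\<And>w. n ^ M dvd poly f w \<Longrightarrow> n ^ r dvd poly b' w"
    using R_quotient_value[OF R(2) b'] by blast
  \<comment> \<open>One lift for all demands: \<open>N\<close> and \<open>M\<close> for the
    numerators of A and B, \<open>Suc r\<close> for f(w) and hence G(w).\<close>
  obtain w where w: "n dvd w - v" "n ^ (N + M + Suc r) dvd poly f w" using lift_root by blast
  have a'w: "n ^ r dvd poly a' w" and b'w: "n ^ r dvd poly b' w" and fw: "n ^ Suc r dvd poly f w"
    using w(2) by (auto intro!: N M intro: power_le_dvd simp del: power_Suc)
  define G where "G = [:- v, 1:] * a' + Polynomial.smult n b' - [:n ^ r * (D * E) * z:]"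
  have "ev \<alpha> G = (\<alpha> - of_int v) * ev \<alpha> a' + of_int n * ev \<alpha> b' - of_int (n ^ r * (D * E)) * of_int z"
    by (simp add: G_def algebra_simps)
  also have "\<dots> = 0"
    unfolding AB(3) a'[symmetric] b'[symmetric] by (simp add: algebra_simps)
  finally have "f dvd G" by (rule min_poly_dvd[OF f])
  then have "poly f w dvd poly G w" by (auto elim!: dvdE)
  then have "n ^ Suc r dvd poly G w" using fw dvd_trans by blast
  moreover have "poly G w = (w - v) * poly a' w + n * poly b' w - n ^ r * (D * E) * z"
    by (simp add: G_def algebra_simps)
  moreover have "n ^ Suc r dvd (w - v) * poly a' w + n * poly b' w"
    using mult_dvd_mono[OF w(1) a'w] mult_dvd_mono[OF dvd_refl[of n] b'w] by simp
  ultimately have "n ^ Suc r dvd n ^ r * (D * E) * z" by (metis dvd_diff_right_iff)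
  then have "n ^ r * n dvd n ^ r * (D * E * z)" by (simp add: mult_ac)
  then have "n dvd D * E * z" using n by (simp add: dvd_mult_cancel_left)
  moreover have "coprime n (D * E)" using D(1) E(1) by (simp add: coprime_commute)
  ultimately show ?thesis by (simp add: coprime_dvd_mult_right_iff)
qed

lemma root_ideal_proper: "root_ideal \<noteq> {0}" "root_ideal \<noteq> R"
proof -
  show "root_ideal \<noteq> {0}" using n_in_root_ideal n by auto
  have "of_int 1 \<notin> root_ideal" using of_int_in_root_ideal[of 1] n by fastforce
  then show "root_ideal \<noteq> R" using R_of_int[of 1] by metis
qed

lemma root_ideal_degree_one: "degree_one L \<eta> root_ideal"
  using degree_one_iff[OF is_ideal_root_ideal root_ideal_proper] root_ideal_cong_int by simp

lemma root_ideal_norm: "int (abs_norm L \<eta> root_ideal) = n"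
proof -
  note I = is_ideal_root_ideal root_ideal_proper(1)
  have "int (abs_norm L \<eta> root_ideal) = int_gen root_ideal"
    by (rule abs_norm_eq_int_gen[OF I root_ideal_cong_int])
  moreover have "n dvd int_gen root_ideal" by (rule of_int_in_root_ideal[OF int_gen_in[OF I]])
  moreover have "int_gen root_ideal dvd n" using of_int_in_ideal_iff[OF I] n_in_root_ideal by blast
  ultimately show ?thesis using n int_gen_pos[OF I] by (simp add: zdvd_antisym_nonneg)
qed

lemma residue_of_root_ideal:
  assumes "0 \<le> v" "v < n" shows "residue_of L \<eta> \<alpha> root_ideal = v"
  unfolding residue_of_def root_ideal_norm
proof (rule the_equality)
  show "0 \<le> v \<and> v < n \<and> \<alpha> - of_int v \<in> root_ideal" using assms diff_in_root_ideal by simp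
  fix u assume u: "0 \<le> u \<and> u < n \<and> \<alpha> - of_int u \<in> root_ideal"
  then have "of_int (u - v) \<in> root_ideal"
    using ideal_diff[OF is_ideal_root_ideal diff_in_root_ideal, of "\<alpha> - of_int u"] by simp
  then have "n dvd u - v" by (rule of_int_in_root_ideal)
  then have "u mod n = v mod n" by (simp add: mod_eq_dvd_iff)
  then show "u = v" using u assms by simp
qed

end

section \<open>From degree one ideals back to roots\<close>

lemma infinite_R: "infinite R"
proof
  assume "finite R"
  then have "finite (range (of_int :: int \<Rightarrow> complex))" by (rule finite_subset[rotated]) auto
  then show False using finite_imageD[of of_int "UNIV :: int set"] by (simp add: inj_on_def infinite_UNIV_int)
qed

text \<open>Reducing f(\<alpha>) = 0 modulo \<open>a\<close> shows that \<open>v\<close> is a root.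
  Its root ideal lies in \<open>a\<close>; conversely an element of \<open>a\<close> differs from an
  integer by an element of the root ideal, and that integer lies in \<open>a\<close>, so it is a
  multiple of n.\<close>

lemma degree_one_ideal_residue:
  assumes a: "is_ideal R a" "degree_one L \<eta> a" "int (abs_norm L \<eta> a) = n"
  defines "v \<equiv> residue_of L \<eta> \<alpha> a"
  shows "0 \<le> v" "v < n" "n dvd poly f v" "ideal_gen R {\<alpha> - of_int v, of_int n} = a"
proof -
  have "a \<noteq> {0}"
  proof
    assume "a = {0}"
    \<comment> \<open>The zero ideal has infinitely many classes, whose \<open>card\<close> is 0,
      against n at least 2.\<close>
    then have "quot_card R a = card ((\<lambda>x. {x}) ` R)"
      unfolding quot_card_def by (intro arg_cong[of _ _ card] image_cong) auto
    then show False using a(3) n infinite_R by (simp add: abs_norm_def card_image)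
  qed
  moreover have "a \<noteq> R"
  proof
    assume "a = R"
    then have "{y \<in> R. x - y \<in> a} = R" if "x \<in> R" for x using R_diff that by blast
    then have "(\<lambda>x. {y \<in> R. x - y \<in> a}) ` R = (\<lambda>_. R) ` R" by (rule image_cong[OF refl])
    then have "(\<lambda>x. {y \<in> R. x - y \<in> a}) ` R = {R}" unfolding image_constant[OF R_simps(1)] .
    then have "quot_card R a = 1" unfolding quot_card_def by simp
    then show False using a(3) n by (simp add: abs_norm_def)
  qed
  ultimately have cong: "\<And>x. x \<in> R \<Longrightarrow> \<exists>z::int. x - of_int z \<in> a"
    using degree_one_iff[OF a(1)] a(2) by simp
  have gen_n: "int_gen a = n" using abs_norm_eq_int_gen[OF a(1) \<open>a \<noteq> {0}\<close> cong] a(3) by simp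
  have iff: "of_int z \<in> a \<longleftrightarrow> n dvd z" for z
    using of_int_in_ideal_iff[OF a(1) \<open>a \<noteq> {0}\<close>] gen_n by simp
  have n_a: "of_int n \<in> a" using iff by simp
  obtain z :: int where z: "\<alpha> - of_int z \<in> a" using cong[OF \<alpha>] by blast
  have "of_int (z - z mod n) \<in> a" unfolding iff by (simp add: mod_eq_dvd_iff[symmetric])
  from is_idealD(3)[OF a(1) z this] have zn: "\<alpha> - of_int (z mod n) \<in> a" by simp
  have v: "v = z mod n"
    unfolding v_def residue_of_def a(3)
  proof (rule the_equality)
    show "0 \<le> z mod n \<and> z mod n < n \<and> \<alpha> - of_int (z mod n) \<in> a" using zn n by simp
    fix u assume u: "0 \<le> u \<and> u < n \<and> \<alpha> - of_int u \<in> a"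
    then have "of_int (u - z) \<in> a" using ideal_diff[OF a(1) z, of "\<alpha> - of_int u"] by simp
    then show "u = z mod n" using iff u by (metis mod_eq_dvd_iff mod_pos_pos_trivial)
  qed
  show "0 \<le> v" "v < n" using v n by simp_all
  obtain h where "ev \<alpha> f = (\<alpha> - of_int v) * ev \<alpha> h + of_int (poly f v)"
    using linear_quotient[of f v] by metis
  then have "of_int (poly f v) = - ((\<alpha> - of_int v) * ev \<alpha> h)" using ev_f by (simp add: eq_neg_iff_add_eq_0 add.commute)
  also have "\<dots> \<in> a"
    using zn v R_poly[OF \<alpha>] by (intro ideal_uminus[OF a(1)] ideal_mult_right[OF a(1)]) auto
  finally show fv: "n dvd poly f v" using iff by blast
  let ?I = "ideal_gen R {\<alpha> - of_int v, of_int n}"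
  have sub: "?I \<subseteq> a" using zn v n_a by (intro ideal_gen_subset[OF a(1)]) simp
  have "a \<subseteq> ?I"
  proof
    fix x assume x: "x \<in> a"
    then obtain t :: int where t: "x - of_int t \<in> ?I"
      using root_ideal_cong_int[OF fv] is_idealD(1)[OF a(1)] unfolding root_ideal_def[OF fv] by blast
    then have "of_int t \<in> a" using ideal_diff[OF a(1) x, of "x - of_int t"] sub by auto
    then have "of_int t \<in> ?I"
      using ideal_int_mult[OF is_ideal_root_ideal[OF fv] n_in_root_ideal[OF fv]] iff
      unfolding root_ideal_def[OF fv] by blast
    from is_idealD(3)[OF is_ideal_root_ideal[OF fv, unfolded root_ideal_def[OF fv]] t this]
    show "x \<in> ?I" by simp
  qed
  then show "?I = a" using sub by blast
qed

end

end

theorem theorem1p1: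
  fixes L :: "complex set" and \<eta> :: nat
  assumes "number_field L" and "\<eta> > 0"
  shows
   "(\<forall>a r (P :: nat \<Rightarrow> complex set) (e :: nat \<Rightarrow> nat).
       is_ideal (loc_ring L \<eta>) a \<and> a \<noteq> {0} \<and> a \<noteq> loc_ring L \<eta> \<and>
       (\<forall>i<r. prime_ideal (loc_ring L \<eta>) (P i) \<and> P i \<noteq> {0} \<and> e i \<ge> 1) \<and>
       (\<forall>i<r. \<forall>j<r. i \<noteq> j \<longrightarrow> P i \<noteq> P j) \<and>
       a = ideal_factor_prod (loc_ring L \<eta>) P e r
     \<longrightarrow>
       (degree_one L \<eta> a \<longleftrightarrow>
          (\<forall>i<r. degree_one L \<eta> (P i) \<and> (ramified L \<eta> (P i) \<longrightarrow> e i = 1)) \<and>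
          (\<forall>i<r. \<forall>j<r. i < j \<longrightarrow>
               gcd (abs_norm L \<eta> (P i)) (abs_norm L \<eta> (P j)) = 1)))
    \<and>
    (\<forall>(\<alpha>::complex) (f::int poly) (n::int).
       \<alpha> \<in> loc_ring L \<eta> \<and> L = Q_adjoin \<alpha> \<and> primitive_min_poly \<alpha> f \<and>
       n \<ge> 2 \<and> coprime n (int \<eta> * poly_discriminant f)
     \<longrightarrow>
       (let V = {v::int. 0 \<le> v \<and> v < n \<and> poly f v mod n = 0};
            A = {a. is_ideal (loc_ring L \<eta>) a \<and> degree_one L \<eta> a \<and> int (abs_norm L \<eta> a) = n};
            \<phi> = (\<lambda>v::int. ideal_gen (loc_ring L \<eta>) {\<alpha> - of_int v, of_int n});
            \<psi> = residue_of L \<eta> \<alpha>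
        in bij_betw \<phi> V A \<and> bij_betw \<psi> A V \<and>
           (\<forall>v\<in>V. \<psi> (\<phi> v) = v) \<and> (\<forall>a\<in>A. \<phi> (\<psi> a) = a)))"
proof -
  interpret localized_integers L \<eta> using assms by unfold_locales
  show ?thesis
  proof (rule conjI; intro allI impI; (elim conjE)?)
    fix a r and P :: "nat \<Rightarrow> complex set" and e :: "nat \<Rightarrow> nat"
    assume "is_ideal R a" "a \<noteq> {0}" "a \<noteq> R"
      "\<forall>i<r. prime_ideal R (P i) \<and> P i \<noteq> {0} \<and> 1 \<le> e i"
      "\<forall>i<r. \<forall>j<r. i \<noteq> j \<longrightarrow> P i \<noteq> P j"
      "a = ideal_factor_prod R P e r"
    then show "degree_one L \<eta> a \<longleftrightarrow>
        (\<forall>i<r. degree_one L \<eta> (P i) \<and> (ramified L \<eta> (P i) \<longrightarrow> e i = 1)) \<and>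
        (\<forall>i<r. \<forall>j<r. i < j \<longrightarrow> gcd (abs_norm L \<eta> (P i)) (abs_norm L \<eta> (P j)) = 1)"
      by (intro degree_one_factorization_iff) auto
  next
    fix \<alpha> :: complex and f :: "int poly" and n :: int
    assume "\<alpha> \<in> R" "L = Q_adjoin \<alpha>" "primitive_min_poly \<alpha> f" "2 \<le> n"
      "coprime n (int \<eta> * poly_discriminant f)"
    note H = this
    define V where "V = {v::int. 0 \<le> v \<and> v < n \<and> poly f v mod n = 0}"
    define A where "A = {a. is_ideal R a \<and> degree_one L \<eta> a \<and> int (abs_norm L \<eta> a) = n}"
    define \<phi> where "\<phi> = (\<lambda>v::int. ideal_gen R {\<alpha> - of_int v, of_int n})"
    define \<psi> where "\<psi> = residue_of L \<eta> \<alpha>"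
    have \<phi>: "\<phi> v \<in> A" "\<psi> (\<phi> v) = v" if "v \<in> V" for v
    proof -
      have v: "n dvd poly f v" "0 \<le> v" "v < n" using that by (auto simp: V_def)
      have eq: "\<phi> v = root_ideal \<alpha> n v" by (simp add: \<phi>_def root_ideal_def[OF H v(1)])
      show "\<phi> v \<in> A"
        unfolding eq A_def
        using is_ideal_root_ideal[OF H v(1)] root_ideal_degree_one[OF H v(1)] root_ideal_norm[OF H v(1)]
        by simp
      show "\<psi> (\<phi> v) = v" unfolding eq \<psi>_def by (rule residue_of_root_ideal[OF H v])
    qed
    have \<psi>: "\<psi> a \<in> V" "\<phi> (\<psi> a) = a" if "a \<in> A" for a
      using degree_one_ideal_residue[OF H, of a] that
      by (simp_all add: V_def A_def \<phi>_def \<psi>_def)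
    have "bij_betw \<phi> V A" "bij_betw \<psi> A V"
      using \<phi> \<psi> by (auto intro!: bij_betw_byWitness[of _ \<psi>] bij_betw_byWitness[of _ \<phi>])
    then show "let V = {v::int. 0 \<le> v \<and> v < n \<and> poly f v mod n = 0};
            A = {a. is_ideal R a \<and> degree_one L \<eta> a \<and> int (abs_norm L \<eta> a) = n};
            \<phi> = (\<lambda>v::int. ideal_gen R {\<alpha> - of_int v, of_int n});
            \<psi> = residue_of L \<eta> \<alpha>
        in bij_betw \<phi> V A \<and> bij_betw \<psi> A V \<and>
           (\<forall>v\<in>V. \<psi> (\<phi> v) = v) \<and> (\<forall>a\<in>A. \<phi> (\<psi> a) = a)"
      unfolding Let_def V_def[symmetric] A_def[symmetric] \<phi>_def[symmetric] \<psi>_def[symmetric]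
      using \<phi>(2) \<psi>(2) by blast
  qed
qed

end
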